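(* Let $M$ be a finitely generated, left cancellative monoid of bounded indegree which is strongly hyperbolic. Then the $\mathcal{J}$-order of $M$ is in $\mathcal{NP}$. If, moreover, $M$ is cancellative, then the $\mathcal{D}$-relation of $M$ is in $\mathcal{NP}$.
   Context: Directed graphs may have loops and multiple edges; $d(u,v)$ is the length of a shortest directed path from $u$ to $v$ ($\infty$ if none). Out-ball $\overrightarrow{\mathcal{B}}_r(x)=\{y : d(x,y)\le r\}$, in-ball $\overleftarrow{\mathcal{B}}_r(x)=\{y : d(y,x)\le r\}$, extended to sets by union. A path $[x_0,\dots,x_n]$ is a geodesic if $n=d(x_0,x_n)$. A directed geodesic triangle is an ordered triple $(p,q,r)$ of geodesics with the end of $p$ equal to the start of $q$ and $p\circ q$ having the same start and end as $r$; it is $\delta$-thin if every vertex of $r$ lies in $\overrightarrow{\mathcal{B}}_\delta(p)\cup\overleftarrow{\mathcal{B}}_\delta(q)$, every vertex of $p$ lies in $\overrightarrow{\mathcal{B}}_\delta(r)\cup\overleftarrow{\mathcal{B}}_\delta(q)$, and every vertex of $q$ lies in $\overrightarrow{\mathcal{B}}_\delta(p)\cup\overleftarrow{\mathcal{B}}_\delta(r)$. A directed graph is strongly $\delta$-hyperbolic if all its directed geodesic triangles are $\delta$-thin. For a monoid $M$ generated by a finite set $A$, the right Cayley graph has vertex set $M$ and an edge $m\to n$ for each $a\in A$ with $ma=n$. $M$ is strongly hyperbolic if its right Cayley graph w.r.t. some finite generating set is strongly $\delta$-hyperbolic for some $\delta\ge0$. $M$ has bounded indegree if for a finite generating set $A$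 there is $\alpha$ such that no $a\in A$ and $\alpha+1$ distinct $x_0,\dots,x_\alpha\in M$ satisfy $x_0a=\dots=x_\alpha a$. Green's relations: $x\le_{\mathcal{J}} y$ iff $MxM\subseteq MyM$; $x\,\mathcal{L}\,y$ iff $Mx=My$; $x\,\mathcal{R}\,y$ iff $xM=yM$; $x\,\mathcal{D}\,y$ iff there is $c$ with $x\,\mathcal{L}\,c$ and $c\,\mathcal{R}\,y$. A relation being "in $\mathcal{NP}$" means deciding, given two words over a finite generating set, whether the represented elements are related, is in $\mathcal{NP}$. *)

theory Defs
  imports "HOL-Library.Extended_Nat"
begin

text \<open>The monoid M is the whole type 'm of class monoid_mult.
  Words over a generating set A are lists with elements in A; a word w represents prod_list w.\<close>

definition generates :: "'m::monoid_mult set \<Rightarrow> bool" where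
  "generates A \<longleftrightarrow> (\<forall>m. \<exists>w. set w \<subseteq> A \<and> prod_list w = m)"

definition fin_gen_set :: "'m::monoid_mult set \<Rightarrow> bool" where
  "fin_gen_set A \<longleftrightarrow> finite A \<and> generates A"

definition left_cancellative :: "'m::monoid_mult itself \<Rightarrow> bool" where
  "left_cancellative _ \<longleftrightarrow> (\<forall>a b c::'m. a * b = a * c \<longrightarrow> b = c)"

definition right_cancellative :: "'m::monoid_mult itself \<Rightarrow> bool" where
  "right_cancellative _ \<longleftrightarrow> (\<forall>a b c::'m. b * a = c * a \<longrightarrow> b = c)"

definition cancellative :: "'m::monoid_mult itself \<Rightarrow> bool" where
  "cancellative T \<longleftrightarrow> left_cancellative T \<and> right_cancellative T"

definition cay_edge :: "'m::monoid_mult set \<Rightarrow> 'm \<Rightarrow> 'm \<Rightarrow> bool" where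
  "cay_edge A m n \<longleftrightarrow> (\<exists>a\<in>A. m * a = n)"

text \<open>Directed distance: length of a shortest directed path (infinity if none).\<close>
definition cay_dist :: "'m::monoid_mult set \<Rightarrow> 'm \<Rightarrow> 'm \<Rightarrow> enat" where
  "cay_dist A u v = (INF w \<in> {w. set w \<subseteq> A \<and> u * prod_list w = v}. enat (length w))"

definition out_ball :: "'m::monoid_mult set \<Rightarrow> nat \<Rightarrow> 'm set \<Rightarrow> 'm set" where
  "out_ball A r X = {y. \<exists>x\<in>X. cay_dist A x y \<le> enat r}"

definition in_ball :: "'m::monoid_mult set \<Rightarrow> nat \<Rightarrow> 'm set \<Rightarrow> 'm set" where
  "in_ball A r X = {y. \<exists>x\<in>X. cay_dist A y x \<le> enat r}"

definition cay_path :: "'m::monoid_mult set \<Rightarrow> 'm list \<Rightarrow> bool" where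
  "cay_path A xs \<longleftrightarrow> xs \<noteq> [] \<and> (\<forall>i. Suc i < length xs \<longrightarrow> cay_edge A (xs ! i) (xs ! Suc i))"

definition cay_geodesic :: "'m::monoid_mult set \<Rightarrow> 'm list \<Rightarrow> bool" where
  "cay_geodesic A xs \<longleftrightarrow> cay_path A xs \<and> enat (length xs - 1) = cay_dist A (hd xs) (last xs)"

definition geod_triangle :: "'m::monoid_mult set \<Rightarrow> 'm list \<Rightarrow> 'm list \<Rightarrow> 'm list \<Rightarrow> bool" where
  "geod_triangle A p q r \<longleftrightarrow> cay_geodesic A p \<and> cay_geodesic A q \<and> cay_geodesic A r \<and>
     last p = hd q \<and> hd r = hd p \<and> last r = last q"

definition thin_triangle :: "'m::monoid_mult set \<Rightarrow> nat \<Rightarrow> 'm list \<Rightarrow> 'm list \<Rightarrow> 'm list \<Rightarrow> bool" where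
  "thin_triangle A \<delta> p q r \<longleftrightarrow>
     set r \<subseteq> out_ball A \<delta> (set p) \<union> in_ball A \<delta> (set q) \<and>
     set p \<subseteq> out_ball A \<delta> (set r) \<union> in_ball A \<delta> (set q) \<and>
     set q \<subseteq> out_ball A \<delta> (set p) \<union> in_ball A \<delta> (set r)"

text \<open>Distances are natural numbers or infinity, so a natural-number delta is no restriction.\<close>
definition strongly_hyperbolic_wrt :: "'m::monoid_mult set \<Rightarrow> nat \<Rightarrow> bool" where
  "strongly_hyperbolic_wrt A \<delta> \<longleftrightarrow>
     (\<forall>p q r. geod_triangle A p q r \<longrightarrow> thin_triangle A \<delta> p q r)"

definition strongly_hyperbolic :: "'m::monoid_mult itself \<Rightarrow> bool" where
  "strongly_hyperbolic _ \<longleftrightarrow> (\<exists>A::'m set. \<exists>\<delta>. fin_gen_set A \<and> strongly_hyperbolic_wrt A \<delta>)"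

definition bounded_indegree :: "'m::monoid_mult itself \<Rightarrow> bool" where
  "bounded_indegree _ \<longleftrightarrow> (\<exists>A::'m set. fin_gen_set A \<and> (\<exists>\<alpha>::nat. \<forall>a\<in>A.
      \<not> (\<exists>X. finite X \<and> card X = Suc \<alpha> \<and> (\<forall>x\<in>X. \<forall>y\<in>X. x * a = y * a))))"

definition J_le :: "'m::monoid_mult \<Rightarrow> 'm \<Rightarrow> bool" where
  "J_le x y \<longleftrightarrow> {a * x * b | a b. True} \<subseteq> {a * y * b | a b. True}"

definition L_rel :: "'m::monoid_mult \<Rightarrow> 'm \<Rightarrow> bool" where
  "L_rel x y \<longleftrightarrow> {a * x | a. True} = {a * y | a. True}"

definition R_rel :: "'m::monoid_mult \<Rightarrow> 'm \<Rightarrow> bool" where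
  "R_rel x y \<longleftrightarrow> {x * a | a. True} = {y * a | a. True}"

definition D_rel :: "'m::monoid_mult \<Rightarrow> 'm \<Rightarrow> bool" where
  "D_rel x y \<longleftrightarrow> (\<exists>c. L_rel x c \<and> R_rel c y)"

text \<open>Single-tape nondeterministic Turing machine over input alphabet 'i. States are naturals;
  tape symbols are Inl (input symbol) or Inr (work symbol); the blank is Inr 0.
  Transitions (q, s, q', s', d): in state q reading s, write s', move head by d, go to q'.\<close>

record 'i ntm =
  tm_alph :: "('i + nat) set"
  tm_states :: "nat set"
  tm_start :: nat
  tm_accept :: nat
  tm_trans :: "(nat \<times> ('i + nat) \<times> nat \<times> ('i + nat) \<times> int) set"

type_synonym 'i tm_config = "nat \<times> (int \<Rightarrow> 'i + nat) \<times> int"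

definition wf_ntm :: "'i set \<Rightarrow> 'i ntm \<Rightarrow> bool" where
  "wf_ntm \<Sigma> M \<longleftrightarrow> finite (tm_states M) \<and> finite (tm_alph M) \<and>
     tm_start M \<in> tm_states M \<and> tm_accept M \<in> tm_states M \<and>
     Inr 0 \<in> tm_alph M \<and> Inl ` \<Sigma> \<subseteq> tm_alph M \<and>
     tm_trans M \<subseteq> tm_states M \<times> tm_alph M \<times> tm_states M \<times> tm_alph M \<times> {-1, 0, 1}"

definition tm_step :: "'i ntm \<Rightarrow> 'i tm_config \<Rightarrow> 'i tm_config \<Rightarrow> bool" where
  "tm_step M c c' \<longleftrightarrow> (case c of (q, t, h) \<Rightarrow> case c' of (q', t', h') \<Rightarrow>
     (\<exists>s' d. (q, t h, q', s', d) \<in> tm_trans M \<and> t' = t(h := s') \<and> h' = h + d))"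

definition tm_init :: "'i ntm \<Rightarrow> 'i list \<Rightarrow> 'i tm_config" where
  "tm_init M w = (tm_start M,
     (\<lambda>i. if 0 \<le> i \<and> i < int (length w) then Inl (w ! nat i) else Inr 0), 0)"

definition accepts_within :: "'i ntm \<Rightarrow> 'i list \<Rightarrow> nat \<Rightarrow> bool" where
  "accepts_within M w T \<longleftrightarrow> (\<exists>cs. cs \<noteq> [] \<and> length cs \<le> Suc T \<and> hd cs = tm_init M w \<and>
     (\<forall>i. Suc i < length cs \<longrightarrow> tm_step M (cs ! i) (cs ! Suc i)) \<and>
     fst (last cs) = tm_accept M)"

definition in_NP :: "'i set \<Rightarrow> 'i list set \<Rightarrow> bool" where
  "in_NP \<Sigma> L \<longleftrightarrow> finite \<Sigma> \<and> (\<exists>M c k. wf_ntm \<Sigma> M \<and>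
     (\<forall>w \<in> lists \<Sigma>. w \<in> L \<longleftrightarrow> accepts_within M w (c * length w ^ k + c)))"

definition encode_pair :: "'m list \<Rightarrow> 'm list \<Rightarrow> 'm option list" where
  "encode_pair u v = map Some u @ None # map Some v"

definition rel_in_NP :: "'m::monoid_mult set \<Rightarrow> ('m \<Rightarrow> 'm \<Rightarrow> bool) \<Rightarrow> bool" where
  "rel_in_NP A R \<longleftrightarrow> in_NP (insert None (Some ` A))
     {encode_pair u v | u v. set u \<subseteq> A \<and> set v \<subseteq> A \<and> R (prod_list u) (prod_list v)}"

end

theory Submission
  imports Defs "HOL-Library.Nat_Bijection"
begin

text \<open>By left cancellation a relation that holds anywhere in the Cayley graph holds at the identity.
  Thin triangles with one side of length at most one can therefore be filled with relators of bounded
  length, so every word is transformed into a geodesic word by polynomially many applications of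
  finitely many relations.

  If \<open>x = a y b\<close> with \<open>a\<close> as short as possible, then thinness of the two triangles spanned by \<open>a\<close>,
  \<open>y\<close>, \<open>b\<close> and \<open>x\<close> shows that a vertex of \<open>a\<close> far from the identity is close to \<open>y\<close>, which by bounded
  indegree happens only linearly often, or has one of finitely many types; two vertices of the same
  type would allow a part of \<open>a\<close> to be cut out. So \<open>a\<close>, and then \<open>b\<close>, can be chosen of linear length.
  In the cancellative case \<open>x D y\<close> means \<open>x = a y b\<close> with units \<open>a\<close> and \<open>b\<close>, and the argument
  applies because the factors of a unit are units.

  A nondeterministic Turing machine guesses \<open>a\<close> and \<open>b\<close> letter by letter, rewrites both sides and
  compares them. All of this is expressed by one finite string rewriting system.\<close>

section \<open>String rewriting\<close>

text \<open>The obstacle is that distances are directed: a thin triangle supplies a short path in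
  one direction only. Left cancellation removes common prefixes, but nothing removes common
  suffixes, so many vertices \<open>z\<close> may satisfy \<open>z * s = g\<close> for the same
  short \<open>s\<close>; this is where the indegree enters.

  Both claims are instances of one statement about a set \<open>T\<close> of admissible factors: the
  whole monoid, or its group of units. Closure under factors keeps a shortened factor in
  \<open>T\<close> and lets an element of \<open>T\<close> be guessed one letter at a time.

  Rules may fire in any order and at any place, so soundness cannot follow an intended derivation.
  It is proved with an automaton that evaluates words and whose final states are compared before and
  after each rule.

  Input words are over an arbitrary \<open>A\<close>, while hyperbolicity belongs to one particular
  \<open>B\<close>; relators over the union of both connect them.\<close>

definition rstep :: "('a list \<times> 'a list) set \<Rightarrow> 'a list \<Rightarrow> 'a list \<Rightarrow> bool" where
  "rstep R x y \<longleftrightarrow> (\<exists>p s l r. (l, r) \<in> R \<and> x = p @ l @ s \<and> y = p @ r @ s)"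

text \<open>The index of \<open>rsteps\<close> is only an upper bound for the number of steps.\<close>

inductive rsteps :: "('a list \<times> 'a list) set \<Rightarrow> nat \<Rightarrow> 'a list \<Rightarrow> 'a list \<Rightarrow> bool" for R where
  refl: "rsteps R n x x"
| step: "rstep R x y \<Longrightarrow> rsteps R n y z \<Longrightarrow> rsteps R (Suc n) x z"

lemma rstep_context:
  assumes "rstep R x y" shows "rstep R (p @ x @ s) (p @ y @ s)"
proof -
  obtain p' s' l r where "(l, r) \<in> R" "x = p' @ l @ s'" "y = p' @ r @ s'"
    using assms by (auto simp: rstep_def)
  then show ?thesis
    unfolding rstep_def by (intro exI[of _ "p @ p'"] exI[of _ "s' @ s"] exI[of _ l] exI[of _ r]) simp
qed

lemma rsteps_context: "rsteps R n x y \<Longrightarrow> rsteps R n (p @ x @ s) (p @ y @ s)"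
  by (induction rule: rsteps.induct) (auto intro: rsteps.intros rstep_context)

lemma rsteps_prefix: "rsteps R n x y \<Longrightarrow> rsteps R n (p @ x) (p @ y)"
  using rsteps_context[of R n x y p "[]"] by simp

lemma rsteps_suffix: "rsteps R n x y \<Longrightarrow> rsteps R n (x @ s) (y @ s)"
  using rsteps_context[of R n x y "[]" s] by simp

lemma rsteps_mono: "rsteps R n x y \<Longrightarrow> n \<le> m \<Longrightarrow> rsteps R m x y"
proof (induction arbitrary: m rule: rsteps.induct)
  case (step x y n z)
  then obtain k where "m = Suc k" "n \<le> k" by (cases m) auto
  with step show ?case by (auto intro: rsteps.step)
qed (rule rsteps.refl)

lemma rsteps_trans: "rsteps R n x y \<Longrightarrow> rsteps R m y z \<Longrightarrow> rsteps R (n + m) x z"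
proof (induction rule: rsteps.induct)
  case (refl n x)
  then show ?case by (rule rsteps_mono) simp
qed (auto intro: rsteps.step)

lemma rsteps_trans_le:
  "rsteps R n x y \<Longrightarrow> rsteps R m y z \<Longrightarrow> n + m \<le> k \<Longrightarrow> rsteps R k x z"
  by (meson rsteps_trans rsteps_mono)

lemma rsteps_single: "rstep R x y \<Longrightarrow> 1 \<le> n \<Longrightarrow> rsteps R n x y"
  using rsteps.step[OF _ rsteps.refl, of R x y 0] by (auto intro: rsteps_mono)

lemma rsteps_rule: "(l, r) \<in> R \<Longrightarrow> 1 \<le> n \<Longrightarrow> rsteps R n (p @ l @ s) (p @ r @ s)"
  by (rule rsteps_single) (auto simp: rstep_def)

lemma rsteps_symmetric:
  assumes "sym R" "rsteps R n x y" shows "rsteps R n y x"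
  using assms(2)
proof (induction rule: rsteps.induct)
  case (step x y n z)
  have "rstep R y x"
    using \<open>rstep R x y\<close> assms(1) unfolding rstep_def by (blast dest: symD)
  then show ?case
    using rsteps_trans[OF step.IH rsteps_single[of R y x 1]] by simp
qed (rule rsteps.refl)

section \<open>Polynomially bounded functions\<close>

text \<open>The shape \<open>c * n ^ k + c\<close> is that of the time bound in
  \<open>in_NP\<close>.\<close>

definition poly_bounded :: "(nat \<Rightarrow> nat) \<Rightarrow> bool" where
  "poly_bounded f \<longleftrightarrow> (\<exists>c k. \<forall>n. f n \<le> c * n ^ k + c)"

lemma poly_bounded_const: "poly_bounded (\<lambda>n. c)"
  unfolding poly_bounded_def by (intro exI[of _ c] exI[of _ 0]) simp

lemma poly_bounded_id: "poly_bounded (\<lambda>n. n)"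
  unfolding poly_bounded_def by (intro exI[of _ 1] exI[of _ 1]) simp

text \<open>The summand 1 pays for \<open>n = 0\<close>, where \<open>0 ^ 0 = 1\<close> can exceed
  \<open>0 ^ l\<close>.\<close>

lemma power_le_power_plus_one:
  fixes n :: nat assumes "k \<le> l" shows "n ^ k \<le> n ^ l + 1"
proof (cases "n = 0")
  case True
  then show ?thesis by (simp add: power_0_left)
next
  case False
  then show ?thesis using power_increasing[OF assms, of n] by simp
qed

lemma poly_bounded_add:
  assumes "poly_bounded f" "poly_bounded g" shows "poly_bounded (\<lambda>n. f n + g n)"
proof -
  obtain c k d l where f: "\<And>n. f n \<le> c * n ^ k + c" and g: "\<And>n. g n \<le> d * n ^ l + d"
    using assms unfolding poly_bounded_def by blast
  have "f n + g n \<le> (2 * (c + d)) * n ^ (k + l) + 2 * (c + d)" for n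
  proof -
    have "c * n ^ k \<le> c * (n ^ (k + l) + 1)" "d * n ^ l \<le> d * (n ^ (k + l) + 1)"
      by (intro mult_le_mono2 power_le_power_plus_one; simp)+
    then have "f n + g n \<le> c * (n ^ (k + l) + 1) + c + (d * (n ^ (k + l) + 1) + d)"
      using f[of n] g[of n] by linarith
    also have "\<dots> \<le> (2 * (c + d)) * n ^ (k + l) + 2 * (c + d)"
      by (simp add: algebra_simps)
    finally show ?thesis .
  qed
  then show ?thesis unfolding poly_bounded_def by blast
qed

lemma poly_bounded_mult:
  assumes "poly_bounded f" "poly_bounded g" shows "poly_bounded (\<lambda>n. f n * g n)"
proof -
  obtain c k d l where f: "\<And>n. f n \<le> c * n ^ k + c" and g: "\<And>n. g n \<le> d * n ^ l + d"
    using assms unfolding poly_bounded_def by blast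
  have "f n * g n \<le> (4 * (c * d)) * n ^ (k + l) + 4 * (c * d)" for n
  proof -
    have "f n * g n \<le> (c * n ^ k + c) * (d * n ^ l + d)"
      by (rule mult_le_mono[OF f g])
    also have "\<dots> = (c * d) * (n ^ (k + l) + n ^ k + n ^ l + 1)"
      by (simp add: algebra_simps power_add)
    also have "\<dots> \<le> (c * d) * (n ^ (k + l) + (n ^ (k + l) + 1) + (n ^ (k + l) + 1) + 1)"
      using power_le_power_plus_one[of k "k + l" n] power_le_power_plus_one[of l "k + l" n]
      by (intro mult_le_mono2 add_le_mono) auto
    also have "\<dots> \<le> (c * d) * (4 * n ^ (k + l) + 4)"
      by (intro mult_le_mono2) simp
    finally show ?thesis by (simp add: algebra_simps)
  qed
  then show ?thesis unfolding poly_bounded_def by blast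
qed

lemmas poly_bounded_intros =
  poly_bounded_const poly_bounded_id poly_bounded_add poly_bounded_mult

section \<open>Runs of Turing machines\<close>

text \<open>As for \<open>rsteps\<close>, the index is an upper bound for the number of steps, so
  time estimates can be weakened freely.\<close>

inductive tm_run :: "'i ntm \<Rightarrow> nat \<Rightarrow> 'i tm_config \<Rightarrow> 'i tm_config \<Rightarrow> bool" for M where
  refl: "tm_run M n c c"
| step: "tm_step M c c' \<Longrightarrow> tm_run M n c' c'' \<Longrightarrow> tm_run M (Suc n) c c''"

lemma tm_run_mono: "tm_run M n x y \<Longrightarrow> n \<le> m \<Longrightarrow> tm_run M m x y"
proof (induction arbitrary: m rule: tm_run.induct)
  case (step x y n z)
  then obtain k where "m = Suc k" "n \<le> k" by (cases m) auto
  with step show ?case by (auto intro: tm_run.step)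
qed (rule tm_run.refl)

lemma tm_run_trans: "tm_run M n x y \<Longrightarrow> tm_run M m y z \<Longrightarrow> tm_run M (n + m) x z"
proof (induction rule: tm_run.induct)
  case (refl n x)
  then show ?case by (rule tm_run_mono) simp
qed (auto intro: tm_run.step)

lemma tm_run_trans_le:
  "tm_run M n x y \<Longrightarrow> tm_run M m y z \<Longrightarrow> n + m \<le> k \<Longrightarrow> tm_run M k x z"
  by (meson tm_run_trans tm_run_mono)

lemma tm_run_invariant:
  assumes "tm_run M n c c'" "I c" "\<And>c c'. I c \<Longrightarrow> tm_step M c c' \<Longrightarrow> I c'"
  shows "I c'"
  using assms by (induction rule: tm_run.induct) auto

lemma tm_run_of_chain:
  assumes "cs \<noteq> []" "\<forall>i. Suc i < length cs \<longrightarrow> tm_step M (cs ! i) (cs ! Suc i)"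
  shows "tm_run M (length cs - 1) (hd cs) (last cs)"
  using assms
proof (induction cs)
  case (Cons c cs)
  show ?case
  proof (cases cs)
    case Nil
    then show ?thesis by (simp add: tm_run.refl)
  next
    case (Cons d ds)
    have "tm_step M c d" using Cons.prems(2)[rule_format, of 0] Cons by simp
    moreover have "\<forall>i. Suc i < length cs \<longrightarrow> tm_step M (cs ! i) (cs ! Suc i)"
      using Cons.prems(2) by (metis Suc_less_eq length_Cons nth_Cons_Suc)
    then have "tm_run M (length cs - 1) (hd cs) (last cs)" using Cons.IH Cons by simp
    ultimately show ?thesis using Cons by (auto intro: tm_run.step)
  qed
qed simp

lemma chain_of_tm_run:
  assumes "tm_run M n c c'"
  shows "\<exists>cs. cs \<noteq> [] \<and> length cs \<le> Suc n \<and> hd cs = c \<and> last cs = c' \<and>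
    (\<forall>i. Suc i < length cs \<longrightarrow> tm_step M (cs ! i) (cs ! Suc i))"
  using assms
proof (induction rule: tm_run.induct)
  case (refl n c)
  show ?case by (intro exI[of _ "[c]"]) simp
next
  case (step c c' n c'')
  then obtain cs where cs: "cs \<noteq> []" "length cs \<le> Suc n" "hd cs = c'" "last cs = c''"
    "\<forall>i. Suc i < length cs \<longrightarrow> tm_step M (cs ! i) (cs ! Suc i)" by blast
  have "tm_step M ((c # cs) ! i) ((c # cs) ! Suc i)" if "Suc i < length (c # cs)" for i
    using that cs step.hyps(1) by (cases i) (auto simp: hd_conv_nth)
  with cs show ?case by (intro exI[of _ "c # cs"]) simp
qed

lemma accepts_within_iff_tm_run:
  "accepts_within M w T \<longleftrightarrow> (\<exists>c. tm_run M T (tm_init M w) c \<and> fst c = tm_accept M)"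
proof
  assume "accepts_within M w T"
  then obtain cs where cs: "cs \<noteq> []" "length cs \<le> Suc T" "hd cs = tm_init M w"
    "\<forall>i. Suc i < length cs \<longrightarrow> tm_step M (cs ! i) (cs ! Suc i)"
    "fst (last cs) = tm_accept M"
    unfolding accepts_within_def by blast
  then have "tm_run M (length cs - 1) (tm_init M w) (last cs)"
    using tm_run_of_chain by metis
  then have "tm_run M T (tm_init M w) (last cs)"
    using cs(2) by (auto intro: tm_run_mono)
  with cs show "\<exists>c. tm_run M T (tm_init M w) c \<and> fst c = tm_accept M" by blast
next
  assume "\<exists>c. tm_run M T (tm_init M w) c \<and> fst c = tm_accept M"
  then show "accepts_within M w T"
    unfolding accepts_within_def using chain_of_tm_run by metis
qed

section \<open>A Turing machine simulating a rewriting system\<close>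

text \<open>A word is stored on the tape with blanks interspersed freely. Blanks commute with all
  symbols, and rules are padded with blanks on both sides, so every rewriting performed on
  the tape preserves length.\<close>

definition padded_rules ::
  "('i + nat) set \<Rightarrow> (('i + nat) list \<times> ('i + nat) list) set \<Rightarrow> (('i + nat) list \<times> ('i + nat) list) set"
where
  "padded_rules \<Gamma> R = (\<lambda>x. ([Inr 0, x], [x, Inr 0])) ` \<Gamma> \<union> (\<lambda>x. ([x, Inr 0], [Inr 0, x])) ` \<Gamma> \<union>
     (\<lambda>(l, r). (l @ replicate (Suc (length r)) (Inr 0), r @ replicate (Suc (length l)) (Inr 0))) ` R"

text \<open>The additional blank produced by \<open>Suc\<close> keeps both sides nonempty even when
  a side of the original rule is empty. The machine relies on this, since it enters a rule by
  reading its symbol at position 0.\<close>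

lemma padded_rules_length:
  "(l, r) \<in> padded_rules \<Gamma> R \<Longrightarrow> length l = length r \<and> 0 < length l"
  by (auto simp: padded_rules_def)

text \<open>Erasing blanks undoes the padding: commutations disappear and a padded rule becomes its
  original. So a rewriting on the tape amounts to at most one step of \<open>R\<close>.\<close>

lemma padded_rules_filter:
  assumes "(l, r) \<in> padded_rules \<Gamma> R" "\<And>l r. (l, r) \<in> R \<Longrightarrow> Inr 0 \<notin> set l \<union> set r"
  shows "filter (\<lambda>x. x \<noteq> Inr 0) l = filter (\<lambda>x. x \<noteq> Inr 0) r \<or>
    (filter (\<lambda>x. x \<noteq> Inr 0) l, filter (\<lambda>x. x \<noteq> Inr 0) r) \<in> R"
proof -
  consider x where "l = [Inr 0, x]" "r = [x, Inr 0]" | x where "l = [x, Inr 0]" "r = [Inr 0, x]"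
    | l' r' where "(l', r') \<in> R" "l = l' @ replicate (Suc (length r')) (Inr 0)"
       "r = r' @ replicate (Suc (length l')) (Inr 0)"
    using assms(1) unfolding padded_rules_def by auto
  then show ?thesis
  proof cases
    case (3 l' r')
    have "filter (\<lambda>x. x \<noteq> Inr 0) l' = l'" "filter (\<lambda>x. x \<noteq> Inr 0) r' = r'"
      using assms(2)[OF 3(1)] by (auto intro!: filter_True)
    then show ?thesis using 3 by simp
  qed auto
qed

lemma rsteps_move_blank_left:
  "set s \<subseteq> \<Gamma> \<Longrightarrow> rsteps (padded_rules \<Gamma> R) (length s) (s @ [Inr 0]) (Inr 0 # s)"
proof (induction s)
  case (Cons x s)
  have "rsteps (padded_rules \<Gamma> R) 1 ([] @ [x, Inr 0] @ s) ([] @ [Inr 0, x] @ s)"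
    by (rule rsteps_rule) (use Cons.prems in \<open>auto simp: padded_rules_def\<close>)
  then have 1: "rsteps (padded_rules \<Gamma> R) 1 (x # Inr 0 # s) (Inr 0 # x # s)" by simp
  have "rsteps (padded_rules \<Gamma> R) (length s) ([x] @ (s @ [Inr 0])) ([x] @ (Inr 0 # s))"
    by (rule rsteps_prefix) (use Cons in auto)
  from rsteps_trans[OF this[simplified] 1] show ?case by simp
qed (simp add: rsteps.refl)

lemma rsteps_move_blank_right:
  "set s \<subseteq> \<Gamma> \<Longrightarrow> rsteps (padded_rules \<Gamma> R) (length s) (Inr 0 # s) (s @ [Inr 0])"
proof (induction s)
  case (Cons x s)
  have "rsteps (padded_rules \<Gamma> R) 1 ([] @ [Inr 0, x] @ s) ([] @ [x, Inr 0] @ s)"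
    by (rule rsteps_rule) (use Cons.prems in \<open>auto simp: padded_rules_def\<close>)
  then have 1: "rsteps (padded_rules \<Gamma> R) 1 (Inr 0 # x # s) (x # Inr 0 # s)" by simp
  have "rsteps (padded_rules \<Gamma> R) (length s) ([x] @ (Inr 0 # s)) ([x] @ (s @ [Inr 0]))"
    by (rule rsteps_prefix) (use Cons in auto)
  from rsteps_trans[OF 1 this[simplified]] show ?case by simp
qed (simp add: rsteps.refl)

lemma rsteps_move_blanks_left:
  assumes "set s \<subseteq> \<Gamma>"
  shows "rsteps (padded_rules \<Gamma> R) (k * length s) (s @ replicate k (Inr 0)) (replicate k (Inr 0) @ s)"
proof (induction k)
  case (Suc k)
  have 1: "rsteps (padded_rules \<Gamma> R) (k * length s) (s @ replicate (Suc k) (Inr 0))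
      (replicate k (Inr 0) @ s @ [Inr 0])"
    using rsteps_suffix[OF Suc, of "[Inr 0]"] by (simp add: replicate_append_same)
  have 2: "rsteps (padded_rules \<Gamma> R) (length s) (replicate k (Inr 0) @ s @ [Inr 0])
      (replicate (Suc k) (Inr 0) @ s)"
    using rsteps_prefix[OF rsteps_move_blank_left[OF assms], of R "replicate k (Inr 0)"]
    by (simp add: replicate_app_Cons_same)
  from rsteps_trans[OF 1 2] show ?case by (simp add: algebra_simps)
qed (simp add: rsteps.refl)

lemma rsteps_move_blanks_right:
  assumes "set s \<subseteq> \<Gamma>"
  shows "rsteps (padded_rules \<Gamma> R) (k * length s) (replicate k (Inr 0) @ s) (s @ replicate k (Inr 0))"
proof (induction k)
  case (Suc k)
  have 1: "rsteps (padded_rules \<Gamma> R) (k * length s) (Inr 0 # replicate k (Inr 0) @ s)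
      (Inr 0 # s @ replicate k (Inr 0))"
    using rsteps_prefix[OF Suc, of "[Inr 0]"] by simp
  have 2: "rsteps (padded_rules \<Gamma> R) (length s) (Inr 0 # s @ replicate k (Inr 0))
      (s @ replicate (Suc k) (Inr 0))"
    using rsteps_suffix[OF rsteps_move_blank_right[OF assms], of R "replicate k (Inr 0)"] by simp
  from rsteps_trans[OF 1 2] show ?case by (simp add: algebra_simps)
qed (simp add: rsteps.refl)

text \<open>The blanks that the rule consumes are fetched from the reserve at the right end: they
  travel left across \<open>s\<close>, the rule acts, and the blanks it leaves travel back.
  \<open>K < N\<close> makes the reserve large enough, and each of the two journeys costs at most
  \<open>(K + 1) * length x\<close>.\<close>

lemma rstep_to_padded:
  assumes "rstep R x y" "set x \<subseteq> \<Gamma>" "K < N"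
    and K: "\<And>l r. (l, r) \<in> R \<Longrightarrow> length l \<le> K \<and> length r \<le> K"
  shows "rsteps (padded_rules \<Gamma> R) (2 * (K + 1) * length x + 1)
    (x @ replicate N (Inr 0)) (y @ replicate (length x + N - length y) (Inr 0))"
proof -
  obtain p s l r where lr: "(l, r) \<in> R" and x: "x = p @ l @ s" and y: "y = p @ r @ s"
    using assms(1) by (auto simp: rstep_def)
  let ?P = "padded_rules \<Gamma> R" and ?b = "\<lambda>k. replicate k (Inr 0)"
  have Kl: "length l \<le> K" "length r \<le> K" using K[OF lr] by auto
  have s: "set s \<subseteq> \<Gamma>" using assms(2) x by auto
  define Z where "Z = N - Suc (length r)"
  have N: "N = Suc (length r) + Z" using Kl assms(3) by (simp add: Z_def)
  have N': "length x + N - length y = Suc (length l) + Z" using N x y by simp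
  have 1: "rsteps ?P (Suc (length r) * length s) (x @ ?b N) ((p @ l) @ (?b (Suc (length r)) @ s) @ ?b Z)"
    using rsteps_context[OF rsteps_move_blanks_left[OF s, of R "Suc (length r)"], of "p @ l" "?b Z"]
    unfolding x N replicate_add by simp
  have "rsteps ?P 1 (p @ (l @ ?b (Suc (length r))) @ (s @ ?b Z)) (p @ (r @ ?b (Suc (length l))) @ (s @ ?b Z))"
    by (rule rsteps_rule) (use lr in \<open>auto simp: padded_rules_def\<close>)
  then have 2: "rsteps ?P 1 ((p @ l) @ (?b (Suc (length r)) @ s) @ ?b Z)
      ((p @ r) @ (?b (Suc (length l)) @ s) @ ?b Z)"
    by simp
  have 3: "rsteps ?P (Suc (length l) * length s) ((p @ r) @ (?b (Suc (length l)) @ s) @ ?b Z)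
      (y @ ?b (Suc (length l) + Z))"
    using rsteps_context[OF rsteps_move_blanks_right[OF s, of R "Suc (length l)"], of "p @ r" "?b Z"]
    unfolding y replicate_add by simp
  have le: "Suc (length r) * length s \<le> (K + 1) * length x" "Suc (length l) * length s \<le> (K + 1) * length x"
    using Kl x by (auto intro!: mult_le_mono simp del: mult_Suc)
  show ?thesis unfolding N'
    by (rule rsteps_trans_le[OF rsteps_trans[OF 1 2] 3]) (use le in linarith)
qed

lemma rstep_set_subset:
  assumes "rstep R x y" "set x \<subseteq> \<Gamma>" "\<And>l r. (l, r) \<in> R \<Longrightarrow> set r \<subseteq> \<Gamma>"
  shows "set y \<subseteq> \<Gamma>"
proof -
  obtain p s l r where "(l, r) \<in> R" "x = p @ l @ s" "y = p @ r @ s"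
    using assms(1) by (auto simp: rstep_def)
  then show ?thesis using assms(2) assms(3)[of l r] by auto
qed

text \<open>A step lengthens the word by at most \<open>K\<close>, so the budget of
  \<open>K + 1\<close> cells per step leaves more than \<open>K\<close> blanks before each
  application.\<close>

lemma rsteps_to_padded:
  assumes "rsteps R n x y" "set x \<subseteq> \<Gamma>" "length x + n * (K + 1) \<le> N"
    and K: "\<And>l r. (l, r) \<in> R \<Longrightarrow> length l \<le> K \<and> length r \<le> K"
    and \<Gamma>: "\<And>l r. (l, r) \<in> R \<Longrightarrow> set r \<subseteq> \<Gamma>"
  shows "rsteps (padded_rules \<Gamma> R) (n * (2 * (K + 1) * N + 1))
    (x @ replicate (N - length x) (Inr 0)) (y @ replicate (N - length y) (Inr 0))"
  using assms(1,2,3)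
proof (induction rule: rsteps.induct)
  case (step x y n z)
  have "length y \<le> length x + K"
    using step.hyps(1) K unfolding rstep_def by fastforce
  moreover have "set y \<subseteq> \<Gamma>"
    by (rule rstep_set_subset[OF step.hyps(1) step.prems(1) \<Gamma>])
  ultimately have IH: "rsteps (padded_rules \<Gamma> R) (n * (2 * (K + 1) * N + 1))
    (y @ replicate (N - length y) (Inr 0)) (z @ replicate (N - length z) (Inr 0))"
    using step.IH step.prems by simp
  have "K < N - length x" using step.prems by simp
  from rstep_to_padded[OF step.hyps(1) step.prems(1) this K]
  have "rsteps (padded_rules \<Gamma> R) (2 * (K + 1) * length x + 1)
    (x @ replicate (N - length x) (Inr 0)) (y @ replicate (N - length y) (Inr 0))"
    using step.prems by simp
  moreover have "2 * (K + 1) * length x \<le> 2 * (K + 1) * N"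
    using step.prems by (intro mult_le_mono2) simp
  ultimately show ?case
    by (elim rsteps_trans_le[OF _ IH]) (simp only: mult_Suc)
qed (rule rsteps.refl)

definition start_word :: "'i list \<Rightarrow> ('i + nat) list" where
  "start_word w = Inr 1 # map Inl w @ [Inr 2]"

text \<open>The offset 5 avoids the control states 0 to 4, and injectivity of
  \<open>prod_encode\<close> lets the rule and the position be recovered from the state.\<close>

abbreviation (input) rule_state :: "nat \<Rightarrow> nat \<Rightarrow> nat" where
  "rule_state i j \<equiv> 5 + prod_encode (i, j)"

text \<open>States 0, 1 and 2 put the end markers around the input. State 3 moves the head freely;
  it may start to apply a rule, and it accepts when it sees \<open>Inr 3\<close>.\<close>

definition rewriting_ntm :: "('i + nat) set \<Rightarrow> (('i + nat) list \<times> ('i + nat) list) list \<Rightarrow> 'i ntm" where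
  "rewriting_ntm \<Gamma> Ps = \<lparr> tm_alph = \<Gamma>,
     tm_states = {0, 1, 2, 3, 4} \<union> (\<Union>i<length Ps. \<Union>j<length (fst (Ps ! i)). {rule_state i j}),
     tm_start = 0, tm_accept = 4,
     tm_trans =
       {(0, s, 1, s, -1) | s. s \<in> \<Gamma>} \<union>
       {(1, Inr 0, 2, Inr 1, 1)} \<union>
       {(2, s, 2, s, 1) | s. s \<in> \<Gamma> \<and> s \<noteq> Inr 0} \<union>
       {(2, Inr 0, 3, Inr 2, 0)} \<union>
       {(3, s, 3, s, d) | s d. s \<in> \<Gamma> \<and> d \<in> {-1, 1}} \<union>
       {(3, Inr 3, 4, Inr 3, 0)} \<union>
       {(3, s, rule_state i 0, s, 0) | s i. s \<in> \<Gamma> \<and> i < length Ps} \<union>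
       {(rule_state i j, fst (Ps ! i) ! j,
         if Suc j < length (fst (Ps ! i)) then rule_state i (Suc j) else 3, snd (Ps ! i) ! j, 1)
        | i j. i < length Ps \<and> j < length (fst (Ps ! i))} \<rparr>"

text \<open>The shift by one puts the first symbol into cell -1, because the left end marker is
  written to the left of the input, which starts in cell 0.\<close>

definition tape_of :: "('i + nat) list \<Rightarrow> int \<Rightarrow> 'i + nat" where
  "tape_of y i = (if 0 \<le> i + 1 \<and> i + 1 < int (length y) then y ! nat (i + 1) else Inr 0)"

lemma tape_of_blanks: "tape_of (y @ replicate n (Inr 0)) = tape_of y"
  by (rule ext) (auto simp: tape_of_def nth_append)

lemma tape_of_nth: "k < length y \<Longrightarrow> tape_of y (int k - 1) = y ! k"
  by (simp add: tape_of_def)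

lemma tape_of_update: "k < length y \<Longrightarrow> (tape_of y)(int k - 1 := x) = tape_of (y[k := x])"
  by (rule ext) (auto simp: tape_of_def nth_list_update)

lemma upto_append:
  fixes i :: int assumes "i \<le> j" "j \<le> k" shows "[i..k - 1] = [i..j - 1] @ [j..k - 1]"
proof (cases "j = k")
  case False
  then show ?thesis using upto_split1[of i j "k - 1"] assms by simp
qed simp

locale rewriting_machine =
  fixes \<Gamma> :: "('i + nat) set" and R and Ps
  assumes fin: "finite \<Gamma>"
    and symbols: "Inr 0 \<in> \<Gamma>" "Inr 1 \<in> \<Gamma>" "Inr 2 \<in> \<Gamma>" "Inr 3 \<in> \<Gamma>"
    and rules: "\<And>l r. (l, r) \<in> R \<Longrightarrow> set l \<union> set r \<subseteq> \<Gamma> - {Inr 0}"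
    and Ps: "set Ps = padded_rules \<Gamma> R"
begin

abbreviation "TM \<equiv> rewriting_ntm \<Gamma> Ps"

lemma Ps_nth:
  assumes "i < length Ps"
  shows "length (snd (Ps ! i)) = length (fst (Ps ! i))" "fst (Ps ! i) \<noteq> []"
    "set (fst (Ps ! i)) \<subseteq> \<Gamma>" "set (snd (Ps ! i)) \<subseteq> \<Gamma>"
proof -
  have mem: "(fst (Ps ! i), snd (Ps ! i)) \<in> padded_rules \<Gamma> R"
    using nth_mem[OF assms] Ps by simp
  from padded_rules_length[OF mem]
  show "length (snd (Ps ! i)) = length (fst (Ps ! i))" "fst (Ps ! i) \<noteq> []" by auto
  have "set l \<subseteq> \<Gamma> \<and> set r \<subseteq> \<Gamma>" if "(l, r) \<in> padded_rules \<Gamma> R" for l r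
    using that rules symbols unfolding padded_rules_def by fastforce
  with mem show "set (fst (Ps ! i)) \<subseteq> \<Gamma>" "set (snd (Ps ! i)) \<subseteq> \<Gamma>" by blast+
qed

lemma wf: "Inl ` \<Sigma> \<subseteq> \<Gamma> \<Longrightarrow> wf_ntm \<Sigma> TM"
proof -
  assume \<Sigma>: "Inl ` \<Sigma> \<subseteq> \<Gamma>"
  have "fst (Ps ! i) ! j \<in> \<Gamma> \<and> snd (Ps ! i) ! j \<in> \<Gamma>"
    if "i < length Ps" "j < length (fst (Ps ! i))" for i j
    using Ps_nth[OF that(1)] that(2) by (metis nth_mem subsetD)
  then show ?thesis
    using \<Sigma> fin symbols Ps_nth(2)
    by (auto simp: wf_ntm_def rewriting_ntm_def)
qed

section \<open>Forward simulation: derivations become runs\<close>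

lemma tm_run_1:
  assumes "(q, t h, q', s', d) \<in> tm_trans TM"
  shows "tm_run TM 1 (q, t, h) (q', t(h := s'), h + d)"
  using tm_run.step[OF _ tm_run.refl, of TM "(q, t, h)" "(q', t(h := s'), h + d)" 0] assms
  by (auto simp: tm_step_def)

lemma run_right:
  assumes "range t \<subseteq> \<Gamma>" shows "tm_run TM n (3, t, h) (3, t, h + int n)"
proof (induction n)
  case (Suc n)
  have "tm_run TM 1 (3, t, h + int n) (3, t(h + int n := t (h + int n)), h + int n + 1)"
    by (rule tm_run_1) (use assms in \<open>auto simp: rewriting_ntm_def\<close>)
  with Suc show ?case using tm_run_trans by (fastforce simp: algebra_simps)
qed (simp add: tm_run.refl)

lemma run_left:
  assumes "range t \<subseteq> \<Gamma>" shows "tm_run TM n (3, t, h) (3, t, h - int n)"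
proof (induction n)
  case (Suc n)
  have "tm_run TM 1 (3, t, h - int n) (3, t(h - int n := t (h - int n)), h - int n + -1)"
    by (rule tm_run_1) (use assms in \<open>auto simp: rewriting_ntm_def\<close>)
  with Suc show ?case using tm_run_trans by (fastforce simp: algebra_simps)
qed (simp add: tm_run.refl)

text \<open>Both sides of a padded rule have the same length, so \<open>l\<close> is overwritten in
  place: after \<open>j\<close> cells the tape shows the first \<open>j\<close> symbols of
  \<open>r\<close> followed by the rest of \<open>l\<close>.\<close>

lemma run_rule_step:
  assumes "i < length Ps" "Ps ! i = (l, r)" "j < length l"
  shows "tm_run TM 1 (rule_state i j, tape_of (p @ take j r @ drop j l @ s), int (length p + j) - 1)
    (if Suc j < length l then rule_state i (Suc j) else 3,
     tape_of (p @ take (Suc j) r @ drop (Suc j) l @ s), int (length p + Suc j) - 1)"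
proof -
  have len: "length r = length l" using Ps_nth(1)[OF assms(1)] assms(2) by simp
  let ?y = "p @ take j r @ drop j l @ s" and ?k = "length p + j"
  have k: "?k < length ?y" "?y ! ?k = l ! j" using assms(3) len by (auto simp: nth_append)
  have y': "?y[?k := r ! j] = p @ take (Suc j) r @ drop (Suc j) l @ s"
    using assms(3) len
    by (simp add: list_update_append min_def take_Suc_conv_app_nth Cons_nth_drop_Suc[symmetric])
  have "tm_run TM 1 (rule_state i j, tape_of ?y, int ?k - 1)
      (if Suc j < length l then rule_state i (Suc j) else 3, (tape_of ?y)(int ?k - 1 := r ! j), int ?k - 1 + 1)"
    by (rule tm_run_1, unfold tape_of_nth[OF k(1)] k(2))
       (use assms in \<open>force simp: rewriting_ntm_def\<close>)
  then show ?thesis unfolding tape_of_update[OF k(1)] y' by (simp add: algebra_simps)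
qed

lemma run_rule_from:
  assumes "i < length Ps" "Ps ! i = (l, r)" "n < length l" "j = length l - Suc n"
  shows "tm_run TM (Suc n) (rule_state i j, tape_of (p @ take j r @ drop j l @ s), int (length p + j) - 1)
    (3, tape_of (p @ r @ s), int (length p + length l) - 1)"
  using assms(3,4)
proof (induction n arbitrary: j)
  case 0
  have len: "length r = length l" using Ps_nth(1)[OF assms(1)] assms(2) by simp
  have "Suc j = length l" "j < length l" using 0 by auto
  then show ?case using run_rule_step[OF assms(1,2), of j p s] len by simp
next
  case (Suc n)
  have "tm_run TM (Suc n) (rule_state i (Suc j), tape_of (p @ take (Suc j) r @ drop (Suc j) l @ s),
      int (length p + Suc j) - 1) (3, tape_of (p @ r @ s), int (length p + length l) - 1)"
    by (rule Suc.IH) (use Suc.prems in auto)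
  moreover have "Suc j < length l" "j < length l" using Suc.prems by auto
  ultimately show ?case
    using run_rule_step[OF assms(1,2), of j p s] tm_run_trans by fastforce
qed

text \<open>The head starts and ends on cell -1: it walks to the redex, spends one step on entering
  the rule, passes over the redex and walks back.\<close>

lemma run_rstep:
  assumes "rstep (padded_rules \<Gamma> R) x y" "set x \<subseteq> \<Gamma>"
  shows "tm_run TM (2 * length x + 1) (3, tape_of x, -1) (3, tape_of y, -1)"
    and "length y = length x" and "set y \<subseteq> \<Gamma>"
proof -
  obtain p s l r where lr: "(l, r) \<in> padded_rules \<Gamma> R" and x: "x = p @ l @ s" and y: "y = p @ r @ s"
    using assms(1) by (auto simp: rstep_def)
  obtain i where i: "i < length Ps" "Ps ! i = (l, r)" using lr Ps by (metis in_set_conv_nth)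
  have len: "length r = length l" "0 < length l" and r: "set r \<subseteq> \<Gamma>"
    using Ps_nth[OF i(1)] i(2) by auto
  show "length y = length x" using x y len by simp
  show set_y: "set y \<subseteq> \<Gamma>" using assms(2) x y r by auto
  have rx: "range (tape_of x) \<subseteq> \<Gamma>" and ry: "range (tape_of y) \<subseteq> \<Gamma>"
    using assms(2) set_y symbols(1) by (auto simp: tape_of_def dest!: nth_mem)
  have 1: "tm_run TM (length p) (3, tape_of x, -1) (3, tape_of x, int (length p) - 1)"
    using run_right[OF rx, of "length p" "-1"] by simp
  have 2: "tm_run TM 1 (3, tape_of x, int (length p) - 1)
      (rule_state i 0, (tape_of x)(int (length p) - 1 := tape_of x (int (length p) - 1)), int (length p) - 1 + 0)"
    by (rule tm_run_1) (use rx i in \<open>auto simp: rewriting_ntm_def\<close>)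
  have 3: "tm_run TM (length l) (rule_state i 0, tape_of x, int (length p) - 1)
      (3, tape_of y, int (length p + length l) - 1)"
    using run_rule_from[OF i, of "length l - 1" 0 p s] len x y by simp
  have 4: "tm_run TM (length p + length l) (3, tape_of y, int (length p + length l) - 1) (3, tape_of y, -1)"
    using run_left[OF ry, of "length p + length l" "int (length p + length l) - 1"] by simp
  have "tm_run TM (length p + 1 + length l + (length p + length l)) (3, tape_of x, -1) (3, tape_of y, -1)"
    using tm_run_trans[OF tm_run_trans[OF tm_run_trans[OF 1 2[simplified]] 3] 4] by simp
  then show "tm_run TM (2 * length x + 1) (3, tape_of x, -1) (3, tape_of y, -1)"
    by (rule tm_run_mono) (simp add: x)
qed

lemma run_rsteps:
  assumes "rsteps (padded_rules \<Gamma> R) n x y" "set x \<subseteq> \<Gamma>"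
  shows "tm_run TM (n * (2 * length x + 1)) (3, tape_of x, -1) (3, tape_of y, -1)"
  using assms
proof (induction rule: rsteps.induct)
  case (step x y n z)
  note y = run_rstep[OF step.hyps(1) step.prems]
  show ?case using tm_run_trans[OF y(1) step.IH[OF y(3)]] unfolding y(2) by (simp only: mult_Suc)
qed (rule tm_run.refl)

lemma run_init:
  assumes "Inl ` set w \<subseteq> \<Gamma>"
  shows "tm_run TM (2 * length w + 4) (tm_init TM w) (3, tape_of (start_word w), -1)"
proof -
  define T0 :: "int \<Rightarrow> 'i + nat" where
    "T0 = (\<lambda>i. if 0 \<le> i \<and> i < int (length w) then Inl (w ! nat i) else Inr 0)"
  let ?T1 = "T0(-1 := Inr 1)"
  have r0: "range T0 \<subseteq> \<Gamma>" using assms symbols(1) by (auto simp: T0_def)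
  have "tm_run TM 1 (0, T0, 0) (1, T0(0 := T0 0), 0 + -1)"
    by (rule tm_run_1) (use r0 in \<open>auto simp: rewriting_ntm_def\<close>)
  then have 1: "tm_run TM 1 (tm_init TM w) (1, T0, -1)"
    by (simp add: tm_init_def T0_def[symmetric]) (simp add: rewriting_ntm_def)
  have "tm_run TM 1 (1, T0, -1) (2, ?T1, -1 + 1)"
    by (rule tm_run_1) (auto simp: rewriting_ntm_def T0_def)
  then have 2: "tm_run TM 1 (1, T0, -1) (2, ?T1, 0)" by simp
  have 3: "tm_run TM n (2, ?T1, 0) (2, ?T1, int n)" if "n \<le> length w" for n
    using that
  proof (induction n)
    case (Suc n)
    have "tm_run TM 1 (2, ?T1, int n) (2, ?T1(int n := ?T1 (int n)), int n + 1)"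
      by (rule tm_run_1) (use r0 Suc.prems assms in \<open>auto simp: rewriting_ntm_def T0_def\<close>)
    then have "tm_run TM 1 (2, ?T1, int n) (2, ?T1, int (Suc n))"
      by (simp only: fun_upd_triv) (simp add: algebra_simps)
    from tm_run_trans[OF Suc.IH this] Suc.prems show ?case by (simp del: fun_upd_apply)
  qed (simp add: tm_run.refl)
  have "tm_run TM 1 (2, ?T1, int (length w)) (3, ?T1(int (length w) := Inr 2), int (length w) + 0)"
    by (rule tm_run_1) (auto simp: rewriting_ntm_def T0_def)
  moreover have T: "?T1(int (length w) := Inr 2) = tape_of (start_word w)"
    by (rule ext) (auto simp: tape_of_def start_word_def T0_def nth_append nth_Cons' nat_diff_distrib nat_add_distrib)
  ultimately have 4: "tm_run TM 1 (2, ?T1, int (length w)) (3, tape_of (start_word w), int (length w))"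
    by simp
  have "range (tape_of (start_word w)) \<subseteq> \<Gamma>"
    unfolding T[symmetric] using r0 symbols by auto
  from run_left[OF this, of "Suc (length w)" "int (length w)"]
  have 5: "tm_run TM (Suc (length w)) (3, tape_of (start_word w), int (length w)) (3, tape_of (start_word w), -1)"
    by simp
  show ?thesis
    using tm_run_trans[OF tm_run_trans[OF tm_run_trans[OF tm_run_trans[OF 1 2] 3[OF order_refl]] 4] 5]
    by (rule tm_run_mono) simp
qed

lemma run_accept:
  assumes "Inr 3 \<in> set y" "set y \<subseteq> \<Gamma>"
  shows "\<exists>c. tm_run TM (length y + 1) (3, tape_of y, -1) c \<and> fst c = tm_accept TM"
proof -
  obtain k where k: "k < length y" "y ! k = Inr 3" using assms(1) by (metis in_set_conv_nth)
  have "range (tape_of y) \<subseteq> \<Gamma>"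
    using assms(2) symbols(1) by (auto simp: tape_of_def dest!: nth_mem)
  from run_right[OF this, of k "-1"] have 1: "tm_run TM k (3, tape_of y, -1) (3, tape_of y, int k - 1)"
    by simp
  have 2: "tm_run TM 1 (3, tape_of y, int k - 1) (4, (tape_of y)(int k - 1 := Inr 3), int k - 1 + 0)"
    by (rule tm_run_1) (use tape_of_nth[OF k(1)] k(2) in \<open>auto simp: rewriting_ntm_def\<close>)
  have "tm_run TM (length y + 1) (3, tape_of y, -1) (4, (tape_of y)(int k - 1 := Inr 3), int k - 1 + 0)"
    by (rule tm_run_trans_le[OF 1 2]) (use k in simp)
  then show ?thesis by (intro exI conjI) (auto simp: rewriting_ntm_def)
qed

text \<open>\<open>N\<close> is the size of the tape segment in use. Each of the \<open>n\<close>
  steps of \<open>R\<close> becomes at most \<open>2 * (K + 1) * N + 1\<close> padded steps, and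
  each of these takes at most \<open>2 * N + 1\<close> machine steps.\<close>

lemma completeness:
  assumes "rsteps R n (start_word w) y" "Inr 3 \<in> set y" "Inl ` set w \<subseteq> \<Gamma>"
    and K: "\<And>l r. (l, r) \<in> R \<Longrightarrow> length l \<le> K \<and> length r \<le> K"
    and N: "N = length w + 2 + n * (K + 1)"
  shows "accepts_within TM w (2 * length w + 4 + n * (2 * (K + 1) * N + 1) * (2 * N + 1) + N + 1)"
proof -
  have x: "set (start_word w) \<subseteq> \<Gamma>" "length (start_word w) = length w + 2"
    using assms(3) symbols by (auto simp: start_word_def)
  \<comment> \<open>The padding uses truncated subtraction; no word of the derivation is longer than
    \<open>N\<close>, so it really fills up to length \<open>N\<close>.\<close>
  have len: "length x' + (N - length x') = N" if "rsteps R m (start_word w) x'" "m \<le> n" for m x'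
  proof -
    have "length x' \<le> length x + m * (K + 1)" if "rsteps R m x x'" for x x' m
      using that
    proof (induction rule: rsteps.induct)
      case (step x y m z)
      then have "length y \<le> length x + K" using K unfolding rstep_def by fastforce
      with step show ?case by simp
    qed simp
    from this[OF that(1)] have "length x' \<le> length w + 2 + m * (K + 1)" using x by simp
    also have "\<dots> \<le> N" unfolding N using that(2) by (intro add_le_mono mult_le_mono) auto
    finally show ?thesis by simp
  qed
  let ?pad = "\<lambda>x. x @ replicate (N - length x) (Inr 0)"
  have sub: "set z \<subseteq> \<Gamma>" if "rsteps R m x z" "set x \<subseteq> \<Gamma>" for m x z
    using that
  proof (induction rule: rsteps.induct)
    case (step x y m z)
    then show ?case using rstep_set_subset[of R x y \<Gamma>] rules by blast
  qed simp
  have "rsteps (padded_rules \<Gamma> R) (n * (2 * (K + 1) * N + 1)) (?pad (start_word w)) (?pad y)"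
  proof (rule rsteps_to_padded[OF assms(1) x(1) _ K])
    show "length (start_word w) + n * (K + 1) \<le> N" using x(2) N by simp
    show "set r \<subseteq> \<Gamma>" if "(l, r) \<in> R" for l r using rules[OF that] by blast
  qed
  moreover have "set (?pad (start_word w)) \<subseteq> \<Gamma>" using x(1) symbols(1) by auto
  ultimately have
    2: "tm_run TM (n * (2 * (K + 1) * N + 1) * (2 * N + 1)) (3, tape_of (start_word w), -1) (3, tape_of y, -1)"
    using run_rsteps len[OF rsteps.refl, of 0] by (fastforce simp: tape_of_blanks)
  obtain c where c: "tm_run TM (length y + 1) (3, tape_of y, -1) c" "fst c = tm_accept TM"
    using run_accept[OF assms(2) sub[OF assms(1) x(1)]] by blast
  have "tm_run TM (2 * length w + 4 + n * (2 * (K + 1) * N + 1) * (2 * N + 1) + N + 1) (tm_init TM w) c"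
    by (rule tm_run_trans_le[OF tm_run_trans[OF run_init[OF assms(3)] 2] c(1)])
       (use len[OF assms(1)] in simp)
  with c(2) show ?thesis unfolding accepts_within_iff_tm_run by blast
qed

text \<open>Derivability is recorded instead of a particular word, since a run may apply rules
  anywhere. The window from \<open>lo\<close> to \<open>hi\<close> turns the non-blank content of
  the infinite tape into a finite list.\<close>

definition stored :: "('i + nat) list \<Rightarrow> (int \<Rightarrow> 'i + nat) \<Rightarrow> bool" where
  "stored x t \<longleftrightarrow> (\<exists>lo hi n. lo \<le> hi \<and> (\<forall>i. i < lo \<or> hi \<le> i \<longrightarrow> t i = Inr 0) \<and>
     rsteps R n x (filter (\<lambda>s. s \<noteq> Inr 0) (map t [lo..hi - 1])))"

text \<open>Blanks outside the window can take part in a rule, so the window is first enlarged to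
  contain the redex. This adds only blanks, which the filter removes.\<close>

lemma stored_rule:
  assumes "stored x t" "(l, r) \<in> padded_rules \<Gamma> R"
    and out: "\<And>i. i < a \<or> a + int (length l) \<le> i \<Longrightarrow> t' i = t i"
    and ins: "\<And>k. k < length l \<Longrightarrow> t (a + int k) = l ! k \<and> t' (a + int k) = r ! k"
  shows "stored x t'"
proof -
  let ?f = "filter (\<lambda>s. s \<noteq> Inr 0)" and ?b = "a + int (length l)"
  obtain lo hi n where "lo \<le> hi" and supp: "\<And>i. i < lo \<or> hi \<le> i \<Longrightarrow> t i = Inr 0"
    and n: "rsteps R n x (?f (map t [lo..hi - 1]))"
    using assms(1) unfolding stored_def by blast
  define lo' where "lo' = min lo a"
  define hi' where "hi' = max hi ?b"
  have le: "lo' \<le> lo" "lo' \<le> a" "hi \<le> hi'" "?b \<le> hi'" by (auto simp: lo'_def hi'_def)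
  have "[lo'..hi' - 1] = [lo'..lo - 1] @ [lo..hi' - 1]"
    using le \<open>lo \<le> hi\<close> by (intro upto_append) auto
  moreover have "[lo..hi' - 1] = [lo..hi - 1] @ [hi..hi' - 1]"
    using le \<open>lo \<le> hi\<close> by (intro upto_append) auto
  moreover have "?f (map t [lo'..lo - 1]) = []" "?f (map t [hi..hi' - 1]) = []"
    using supp by (auto simp: filter_empty_conv)
  ultimately have "?f (map t [lo'..hi' - 1]) = ?f (map t [lo..hi - 1])"
    by simp
  with n have n': "rsteps R n x (?f (map t [lo'..hi' - 1]))" by simp
  have len: "length r = length l" using padded_rules_length[OF assms(2)] by simp
  have split: "[lo'..hi' - 1] = [lo'..a - 1] @ [a..?b - 1] @ [?b..hi' - 1]"
    by (subst upto_append[of lo' a hi'], use le in simp, use le in simp,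
        subst upto_append[of a ?b hi'], use le in auto)
  have "map t [a..?b - 1] = l" "map t' [a..?b - 1] = r"
    using ins len by (auto intro!: nth_equalityI)
  moreover have "map t' [lo'..a - 1] = map t [lo'..a - 1]" "map t' [?b..hi' - 1] = map t [?b..hi' - 1]"
    using out by auto
  ultimately have eqs: "?f (map t [lo'..hi' - 1]) = ?f (map t [lo'..a - 1]) @ ?f l @ ?f (map t [?b..hi' - 1])"
    "?f (map t' [lo'..hi' - 1]) = ?f (map t [lo'..a - 1]) @ ?f r @ ?f (map t [?b..hi' - 1])"
    unfolding split map_append filter_append by (simp_all only:)
  have "?f l = ?f r \<or> (?f l, ?f r) \<in> R"
    by (rule padded_rules_filter[OF assms(2)]) (use rules in blast)
  then have "rsteps R 1 (?f (map t [lo'..hi' - 1])) (?f (map t' [lo'..hi' - 1]))"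
    unfolding eqs by (elim disjE) (simp only: rsteps.refl, rule rsteps_rule, simp_all)
  from rsteps_trans[OF n' this] have "rsteps R (n + 1) x (?f (map t' [lo'..hi' - 1]))" .
  moreover have "\<forall>i. i < lo' \<or> hi' \<le> i \<longrightarrow> t' i = Inr 0"
  proof (intro allI impI)
    fix i assume "i < lo' \<or> hi' \<le> i"
    then have "i < a \<or> ?b \<le> i" "i < lo \<or> hi \<le> i" using le by linarith+
    then show "t' i = Inr 0" using supp out by metis
  qed
  moreover have "lo' \<le> hi'" using le \<open>lo \<le> hi\<close> by simp
  ultimately show ?thesis unfolding stored_def by blast
qed

lemma stored_symbol:
  assumes "stored x t" "t h = s" "s \<noteq> Inr 0"
  shows "\<exists>n y. rsteps R n x y \<and> s \<in> set y"
proof -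
  obtain lo hi n where supp: "\<And>i. i < lo \<or> hi \<le> i \<Longrightarrow> t i = Inr 0"
    and n: "rsteps R n x (filter (\<lambda>s. s \<noteq> Inr 0) (map t [lo..hi - 1]))"
    using assms(1) unfolding stored_def by blast
  have "h \<in> {lo..hi - 1}" using supp[of h] assms by force
  then have "s \<in> set (filter (\<lambda>s. s \<noteq> Inr 0) (map t [lo..hi - 1]))" using assms by auto
  with n show ?thesis by blast
qed

definition input_tape :: "'i list \<Rightarrow> int \<Rightarrow> 'i + nat" where
  "input_tape w = (\<lambda>i. if 0 \<le> i \<and> i < int (length w) then Inl (w ! nat i) else Inr 0)"

lemma stored_start: "stored (start_word w) ((input_tape w)(-1 := Inr 1, int (length w) := Inr 2))"
proof -
  let ?t = "(input_tape w)(-1 := Inr 1, int (length w) := Inr 2)"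
  have eq: "map ?t [-1..int (length w) + 1 - 1] = start_word w"
    by (rule nth_equalityI)
       (auto simp: start_word_def input_tape_def nth_append nth_Cons' nat_diff_distrib nat_add_distrib)
  have "filter (\<lambda>s. s \<noteq> Inr 0) (start_word w) = start_word w"
    by (auto simp: start_word_def intro!: filter_True)
  then have "rsteps R 0 (start_word w) (filter (\<lambda>s. s \<noteq> Inr 0) (map ?t [-1..int (length w) + 1 - 1]))"
    unfolding eq by (simp add: rsteps.refl)
  moreover have "\<forall>i. i < -1 \<or> int (length w) + 1 \<le> i \<longrightarrow> ?t i = Inr 0"
    by (auto simp: input_tape_def)
  moreover have "-1 \<le> int (length w) + 1" by simp
  ultimately show ?thesis unfolding stored_def by blast
qed

text \<open>In the middle of the application of a rule the invariant refers to the tape before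
  that application.\<close>

definition tm_invariant :: "'i list \<Rightarrow> 'i tm_config \<Rightarrow> bool" where
  "tm_invariant w c \<longleftrightarrow> (case c of (q, t, h) \<Rightarrow>
     (q = 0 \<and> t = input_tape w \<and> h = 0) \<or>
     (q = 1 \<and> t = input_tape w \<and> h = -1) \<or>
     (q = 2 \<and> t = (input_tape w)(-1 := Inr 1) \<and> 0 \<le> h \<and> h \<le> int (length w)) \<or>
     (q = 3 \<and> stored (start_word w) t) \<or>
     (q = 4 \<and> stored (start_word w) t \<and> t h = Inr 3) \<or>
     (\<exists>i j t0. q = rule_state i j \<and> i < length Ps \<and> j < length (fst (Ps ! i)) \<and>
        stored (start_word w) t0 \<and> (\<forall>k. k < h - int j \<or> h \<le> k \<longrightarrow> t k = t0 k) \<and>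
        (\<forall>k<j. t0 (h - int j + int k) = fst (Ps ! i) ! k \<and> t (h - int j + int k) = snd (Ps ! i) ! k)))"

lemma rule_state_invariant_step:
  assumes "i < length Ps" "j < length (fst (Ps ! i))" "stored x t0"
    and out: "\<forall>k. k < h - int j \<or> h \<le> k \<longrightarrow> t k = t0 k"
    and ins: "\<forall>k<j. t0 (h - int j + int k) = fst (Ps ! i) ! k \<and> t (h - int j + int k) = snd (Ps ! i) ! k"
    and th: "t h = fst (Ps ! i) ! j" and t': "t' = t(h := snd (Ps ! i) ! j)"
  shows "\<And>k. k < h + 1 - int (Suc j) \<or> h + 1 \<le> k \<Longrightarrow> t' k = t0 k"
    and "\<And>k. k < Suc j \<Longrightarrow> t0 (h + 1 - int (Suc j) + int k) = fst (Ps ! i) ! k \<and>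
        t' (h + 1 - int (Suc j) + int k) = snd (Ps ! i) ! k"
    and "Suc j = length (fst (Ps ! i)) \<Longrightarrow> stored x t'"
proof -
  show 1: "t' k = t0 k" if "k < h + 1 - int (Suc j) \<or> h + 1 \<le> k" for k
    using that out t' by auto
  show 2: "t0 (h + 1 - int (Suc j) + int k) = fst (Ps ! i) ! k \<and>
        t' (h + 1 - int (Suc j) + int k) = snd (Ps ! i) ! k" if "k < Suc j" for k
  proof (cases "k = j")
    case True
    then show ?thesis using th t' out by simp
  next
    case False
    then show ?thesis using that ins t' by simp
  qed
  have "(fst (Ps ! i), snd (Ps ! i)) \<in> padded_rules \<Gamma> R"
    using nth_mem[OF assms(1)] Ps by simp
  then show "stored x t'" if "Suc j = length (fst (Ps ! i))"
    by (rule stored_rule[OF assms(3), where a = "h + 1 - int (Suc j)"]) (use 1 2 that in auto)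
qed

lemma tm_invariant_step:
  assumes "tm_invariant w c" "tm_step TM c c'" shows "tm_invariant w c'"
proof -
  obtain q t h where c: "c = (q, t, h)" by (cases c)
  obtain q' t' h' where c': "c' = (q', t', h')" by (cases c')
  obtain s' d where tr: "(q, t h, q', s', d) \<in> tm_trans TM" and t': "t' = t(h := s')" and h': "h' = h + d"
    using assms(2) unfolding c c' tm_step_def by auto
  have inv: "tm_invariant w (q, t, h)" using assms(1) c by simp
  consider (0) "q = 0" "q' = 1" "s' = t h" "d = -1"
    | (1) "q = 1" "q' = 2" "t h = Inr 0" "s' = Inr 1" "d = 1"
    | (2) "q = 2" "q' = 2" "t h \<noteq> Inr 0" "s' = t h" "d = 1"
    | (23) "q = 2" "q' = 3" "t h = Inr 0" "s' = Inr 2" "d = 0"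
    | (3) "q = 3" "q' = 3" "s' = t h"
    | (34) "q = 3" "q' = 4" "t h = Inr 3" "s' = Inr 3" "d = 0"
    | (35) i where "q = 3" "q' = rule_state i 0" "s' = t h" "d = 0" "i < length Ps"
    | (5) i j where "q = rule_state i j" "i < length Ps" "j < length (fst (Ps ! i))"
       "t h = fst (Ps ! i) ! j" "s' = snd (Ps ! i) ! j" "d = 1"
       "q' = (if Suc j < length (fst (Ps ! i)) then rule_state i (Suc j) else 3)"
    using tr unfolding rewriting_ntm_def ntm.simps
    by (elim UnE; clarsimp; metis)
  then have "tm_invariant w (q', t', h')"
  proof cases
    case 0
    then show ?thesis using inv t' h' by (simp add: tm_invariant_def)
  next
    case 1
    then show ?thesis using inv t' h' by (simp add: tm_invariant_def)
  next
    case 2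
    then have *: "t = (input_tape w)(-1 := Inr 1)" "0 \<le> h" "h \<le> int (length w)"
      using inv by (auto simp: tm_invariant_def)
    have "h \<noteq> int (length w)" using 2(3) * by (auto simp: input_tape_def)
    moreover have "t' = t" using 2 t' by simp
    ultimately show ?thesis using 2 * h' by (simp add: tm_invariant_def)
  next
    case 23
    then have *: "t = (input_tape w)(-1 := Inr 1)" "0 \<le> h" "h \<le> int (length w)"
      using inv by (auto simp: tm_invariant_def)
    then have "h = int (length w)" using 23(3) by (auto simp: input_tape_def split: if_splits)
    then show ?thesis using stored_start[of w] 23 * t' by (simp add: tm_invariant_def)
  next
    case 3
    then show ?thesis using inv t' by (simp add: tm_invariant_def)
  next
    case 34
    then show ?thesis using inv t' h' by (simp add: tm_invariant_def fun_upd_idem)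
  next
    case (35 i)
    then have "stored (start_word w) t" using inv by (simp add: tm_invariant_def)
    then show ?thesis using 35 t' h' Ps_nth(2)[OF 35(5)]
      unfolding tm_invariant_def prod.case
      by (intro disjI2 exI[of _ i] exI[of _ 0] exI[of _ t]) auto
  next
    case (5 i j)
    then obtain t0 where t0: "stored (start_word w) t0" "\<forall>k. k < h - int j \<or> h \<le> k \<longrightarrow> t k = t0 k"
      "\<forall>k<j. t0 (h - int j + int k) = fst (Ps ! i) ! k \<and> t (h - int j + int k) = snd (Ps ! i) ! k"
      using inv by (auto simp: tm_invariant_def)
    note st = rule_state_invariant_step[OF 5(2,3) t0 5(4) t'[unfolded 5(5)]]
    show ?thesis
    proof (cases "Suc j < length (fst (Ps ! i))")
      case True
      have hq: "h' = h + 1" "q' = rule_state i (Suc j)" using h' 5 True by auto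
      show ?thesis
        unfolding tm_invariant_def prod.case hq
      proof (intro disjI2, rule exI[of _ i], rule exI[of _ "Suc j"], rule exI[of _ t0], intro conjI allI impI)
        show "t' k = t0 k" if "k < h + 1 - int (Suc j) \<or> h + 1 \<le> k" for k by (rule st(1)[OF that])
      next
        fix k assume "k < Suc j"
        then show "t0 (h + 1 - int (Suc j) + int k) = fst (Ps ! i) ! k"
          "t' (h + 1 - int (Suc j) + int k) = snd (Ps ! i) ! k"
          using st(2) by simp_all
      qed (use 5(2) True t0(1) in simp_all)
    next
      case False
      then show ?thesis using st(3) 5 by (simp add: tm_invariant_def)
    qed
  qed
  then show ?thesis by (simp add: c')
qed

text \<open>Any accepting run yields a derivation, whatever its length; the time bound matters only
  for completeness.\<close>

lemma soundness:
  assumes "accepts_within TM w T" shows "\<exists>n y. rsteps R n (start_word w) y \<and> Inr 3 \<in> set y"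
proof -
  obtain c where c: "tm_run TM T (tm_init TM w) c" "fst c = 4"
    using assms unfolding accepts_within_iff_tm_run by (auto simp: rewriting_ntm_def)
  have "tm_invariant w (tm_init TM w)"
    by (simp add: tm_invariant_def tm_init_def input_tape_def rewriting_ntm_def)
  then have "tm_invariant w c"
    by (rule tm_run_invariant[where I = "tm_invariant w", OF c(1)]) (rule tm_invariant_step)
  then have "stored (start_word w) (fst (snd c))" "fst (snd c) (snd (snd c)) = Inr 3"
    using c(2) by (auto simp: tm_invariant_def split: prod.splits)
  from stored_symbol[OF this] show ?thesis by simp
qed

end

theorem in_NP_rewriting:
  fixes \<Sigma> :: "'i set" and R :: "(('i + nat) list \<times> ('i + nat) list) set"
  assumes "finite \<Sigma>" "finite R" "poly_bounded f"
    and no_blank: "\<And>l r. (l, r) \<in> R \<Longrightarrow> Inr 0 \<notin> set l \<union> set r"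
    and sound: "\<And>w n y. w \<in> lists \<Sigma> \<Longrightarrow> rsteps R n (start_word w) y \<Longrightarrow> Inr 3 \<in> set y \<Longrightarrow> w \<in> L"
    and complete: "\<And>w. w \<in> lists \<Sigma> \<Longrightarrow> w \<in> L \<Longrightarrow>
      \<exists>y. rsteps R (f (length w)) (start_word w) y \<and> Inr 3 \<in> set y"
  shows "in_NP \<Sigma> L"
proof -
  define \<Gamma> :: "('i + nat) set" where
    "\<Gamma> = Inl ` \<Sigma> \<union> {Inr 0, Inr 1, Inr 2, Inr 3} \<union> (\<Union>(l, r)\<in>R. set l \<union> set r)"
  have fin: "finite \<Gamma>" using assms(1,2) by (auto simp: \<Gamma>_def)
  then have "finite (padded_rules \<Gamma> R)" using assms(2) by (simp add: padded_rules_def)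
  then obtain Ps where Ps: "set Ps = padded_rules \<Gamma> R" using finite_list by blast
  interpret rewriting_machine \<Gamma> R Ps
  proof
    show "set l \<union> set r \<subseteq> \<Gamma> - {Inr 0}" if "(l, r) \<in> R" for l r
      using that no_blank[OF that] by (auto simp: \<Gamma>_def)
  qed (use fin Ps in \<open>auto simp: \<Gamma>_def\<close>)
  define K where "K = (\<Sum>(l, r)\<in>R. length l + length r)"
  have K: "length l \<le> K \<and> length r \<le> K" if "(l, r) \<in> R" for l r
    using member_le_sum[OF that _ assms(2), of "\<lambda>(l, r). length l + length r"] by (auto simp: K_def)
  define N where "N = (\<lambda>m. m + 2 + f m * (K + 1))"
  define T where "T = (\<lambda>m. 2 * m + 4 + f m * (2 * (K + 1) * N m + 1) * (2 * N m + 1) + N m + 1)"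
  have "poly_bounded T"
    unfolding T_def N_def by (intro poly_bounded_intros assms(3))
  then obtain c k where T: "\<And>m. T m \<le> c * m ^ k + c" unfolding poly_bounded_def by blast
  have \<Sigma>: "Inl ` \<Sigma> \<subseteq> \<Gamma>" by (auto simp: \<Gamma>_def)
  have "w \<in> L \<longleftrightarrow> accepts_within TM w (c * length w ^ k + c)" if w: "w \<in> lists \<Sigma>" for w
  proof
    assume "w \<in> L"
    then obtain y where y: "rsteps R (f (length w)) (start_word w) y" "Inr 3 \<in> set y"
      using complete[OF w] by blast
    have "accepts_within TM w (T (length w))"
      unfolding T_def by (rule completeness[OF y _ K]) (use w \<Sigma> in \<open>auto simp: N_def\<close>)
    then show "accepts_within TM w (c * length w ^ k + c)"
      unfolding accepts_within_iff_tm_run using T tm_run_mono by blast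
  next
    assume "accepts_within TM w (c * length w ^ k + c)"
    from soundness[OF this] show "w \<in> L" using sound[OF w] by blast
  qed
  with wf[OF \<Sigma>] assms(1) show ?thesis unfolding in_NP_def by blast
qed

section \<open>Geodesic words and thin triangles\<close>

text \<open>The distance from 1 to \<open>m\<close> in the Cayley graph. The \<open>LEAST\<close> is
  attained as soon as \<open>B\<close> generates the monoid.\<close>

definition word_length :: "'m::monoid_mult set \<Rightarrow> 'm \<Rightarrow> nat" where
  "word_length B m = (LEAST n. \<exists>w. set w \<subseteq> B \<and> prod_list w = m \<and> length w = n)"

definition geodesic_word :: "'m::monoid_mult set \<Rightarrow> 'm list \<Rightarrow> bool" where
  "geodesic_word B w \<longleftrightarrow> set w \<subseteq> B \<and> length w = word_length B (prod_list w)"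

abbreviation prefix_prod :: "'m::monoid_mult list \<Rightarrow> nat \<Rightarrow> 'm" where
  "prefix_prod w i \<equiv> prod_list (take i w)"

abbreviation suffix_prod :: "'m::monoid_mult list \<Rightarrow> nat \<Rightarrow> 'm" where
  "suffix_prod w i \<equiv> prod_list (drop i w)"

lemma prefix_suffix_prod: "prefix_prod w i * suffix_prod w i = prod_list w"
  by (simp flip: prod_list.append)

definition word_path :: "'m::monoid_mult \<Rightarrow> 'm list \<Rightarrow> 'm list" where
  "word_path x w = map (\<lambda>i. x * prefix_prod w i) [0..<Suc (length w)]"

lemma set_word_path: "set (word_path x w) = (\<lambda>i. x * prefix_prod w i) ` {..length w}"
proof -
  have "set [0..<Suc (length w)] = {..length w}" by auto
  then show ?thesis unfolding word_path_def set_map by (simp only:)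
qed

lemma word_path_ends: "hd (word_path x w) = x" "last (word_path x w) = x * prod_list w"
  by (simp_all add: word_path_def hd_map del: upt_Suc) simp

definition relators :: "'m::monoid_mult set \<Rightarrow> nat \<Rightarrow> ('m list \<times> 'm list) set" where
  "relators G D = {(u, v). set u \<subseteq> G \<and> set v \<subseteq> G \<and> length u \<le> D \<and> length v \<le> D \<and>
     prod_list u = prod_list v}"

lemma relatorsI:
  "set u \<subseteq> G \<Longrightarrow> set v \<subseteq> G \<Longrightarrow> length u \<le> D \<Longrightarrow> length v \<le> D \<Longrightarrow> prod_list u = prod_list v \<Longrightarrow>
    (u, v) \<in> relators G D"
  by (simp add: relators_def)

lemma sym_relators: "sym (relators G D)"
  by (auto simp: relators_def intro!: symI)

lemma finite_relators: "finite G \<Longrightarrow> finite (relators G D)"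
  by (rule finite_subset[of _ "{u. set u \<subseteq> G \<and> length u \<le> D} \<times> {u. set u \<subseteq> G \<and> length u \<le> D}"])
     (auto simp: relators_def finite_lists_length_le)

text \<open>The common abstraction of the two cases: \<open>UNIV\<close> for the J-order, and the
  units of a cancellative monoid for the D-relation.\<close>

definition factor_closed :: "'m::monoid_mult set \<Rightarrow> bool" where
  "factor_closed T \<longleftrightarrow> 1 \<in> T \<and> (\<forall>x y. x * y \<in> T \<longleftrightarrow> x \<in> T \<and> y \<in> T)"

section \<open>Fibres of right multiplication\<close>

lemma card_UN_bound:
  assumes "finite I" "\<And>i. i \<in> I \<Longrightarrow> card (A i) \<le> k"
  shows "card (\<Union>i\<in>I. A i) \<le> card I * k"
  using card_UN_le[OF assms(1), of A] sum_bounded_above[of I "\<lambda>i. card (A i)" k] assms(2) by simp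

text \<open>The hypothesis bounds the fibres of single letters of some generating set
  \<open>C\<close>. Fibres of a word are iterated unions of these, so the bounds multiply along a
  word for \<open>s\<close>, and \<open>C\<close> disappears from the conclusion.\<close>

lemma bounded_indegree_card:
  assumes "bounded_indegree TYPE('m::monoid_mult)"
  shows "\<exists>I. \<forall>g. finite {z. z * (s::'m) = g} \<and> card {z. z * s = g} \<le> I"
proof -
  obtain C :: "'m set" and \<alpha> where C: "fin_gen_set C"
    and \<alpha>: "\<And>a X. a \<in> C \<Longrightarrow> finite X \<Longrightarrow> card X = Suc \<alpha> \<Longrightarrow> \<not> (\<forall>x\<in>X. \<forall>y\<in>X. x * a = y * a)"
    using assms unfolding bounded_indegree_def by blast
  have letter: "finite {z. z * a = g} \<and> card {z. z * a = g} \<le> \<alpha>" if "a \<in> C" for a g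
  proof (rule ccontr)
    assume "\<not> ?thesis"
    then have "infinite {z. z * a = g} \<or> Suc \<alpha> \<le> card {z. z * a = g}" by auto
    then obtain X where X: "X \<subseteq> {z. z * a = g}" "finite X" "card X = Suc \<alpha>"
      using infinite_arbitrarily_large[of "{z. z * a = g}" "Suc \<alpha>"]
        obtain_subset_with_card_n[of "Suc \<alpha>" "{z. z * a = g}"] by (elim disjE) auto
    then show False using \<alpha>[OF that X(2,3)] by auto
  qed
  have "\<exists>I. \<forall>g. finite {z. z * prod_list w = g} \<and> card {z. z * prod_list w = g} \<le> I"
    if "set w \<subseteq> C" for w
    using that
  proof (induction w)
    case Nil
    then show ?case by (intro exI[of _ 1]) simp
  next
    case (Cons a w)
    then obtain I where I: "\<And>g. finite {z. z * prod_list w = g} \<and> card {z. z * prod_list w = g} \<le> I" by auto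
    have a: "a \<in> C" using Cons.prems by simp
    have "finite {z. z * prod_list (a # w) = g} \<and> card {z. z * prod_list (a # w) = g} \<le> I * \<alpha>" for g
    proof -
      have eq: "{z. z * prod_list (a # w) = g} = (\<Union>y\<in>{y. y * prod_list w = g}. {z. z * a = y})"
        by (auto simp: mult.assoc)
      have "card (\<Union>y\<in>{y. y * prod_list w = g}. {z. z * a = y}) \<le> card {y. y * prod_list w = g} * \<alpha>"
        by (rule card_UN_bound) (use I letter[OF a] in auto)
      also have "\<dots> \<le> I * \<alpha>" using I by simp
      finally show ?thesis unfolding eq using I letter[OF a] by blast
    qed
    then show ?case by blast
  qed
  moreover obtain w where "set w \<subseteq> C" "prod_list w = s"
    using C unfolding fin_gen_set_def generates_def by blast
  ultimately show ?thesis by blast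
qed

lemma bounded_indegree_card_uniform:
  assumes "bounded_indegree TYPE('m::monoid_mult)" "finite S"
  shows "\<exists>I. \<forall>s\<in>S. \<forall>g. finite {z. z * (s::'m) = g} \<and> card {z. z * s = g} \<le> I"
proof -
  obtain f where f: "\<And>s g. finite {z. z * (s::'m) = g} \<and> card {z. z * s = g} \<le> f s"
    using bounded_indegree_card[OF assms(1)] by metis
  have "f s \<le> sum f S" if "s \<in> S" for s using member_le_sum[of s S f] that assms(2) by simp
  then show ?thesis using f by (meson le_trans)
qed

locale hyperbolic_monoid =
  fixes B :: "'m::monoid_mult set" and \<delta> :: nat
  assumes left_canc: "left_cancellative TYPE('m)"
    and gen: "fin_gen_set B"
    and hyp: "strongly_hyperbolic_wrt B \<delta>"
begin

section \<open>Geodesic words and directed distances\<close>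

abbreviation "wlen \<equiv> word_length B"
abbreviation "geod \<equiv> geodesic_word B"

lemma cancel: "(a::'m) * b = a * c \<Longrightarrow> b = c"
  using left_canc unfolding left_cancellative_def by blast

lemma ex_geod: "\<exists>w. geod w \<and> prod_list w = m"
proof -
  obtain w where "set w \<subseteq> B" "prod_list w = m"
    using gen unfolding fin_gen_set_def generates_def by blast
  then have "\<exists>n. \<exists>w. set w \<subseteq> B \<and> prod_list w = m \<and> length w = n" by blast
  from LeastI_ex[OF this] show ?thesis unfolding geodesic_word_def word_length_def by blast
qed

lemma geod_set: "geod w \<Longrightarrow> set w \<subseteq> B"
  and geod_length: "geod w \<Longrightarrow> length w = wlen (prod_list w)"
  by (auto simp: geodesic_word_def)

lemma wlen_le: "set w \<subseteq> B \<Longrightarrow> wlen (prod_list w) \<le> length w"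
  unfolding word_length_def by (rule Least_le) blast

lemma wlen_one: "wlen 1 = 0"
  using wlen_le[of "[]"] by simp

lemma wlen_mult: "wlen (x * y) \<le> wlen x + wlen y"
proof -
  obtain u v where "geod u" "prod_list u = x" "geod v" "prod_list v = y" using ex_geod by meson
  then show ?thesis using wlen_le[of "u @ v"] by (auto simp: geodesic_word_def)
qed

lemma geod_append:
  assumes "geod (u @ v)" shows "geod u" "geod v"
proof -
  have "wlen (prod_list u * prod_list v) = length u + length v" "set u \<subseteq> B" "set v \<subseteq> B"
    using assms by (auto simp: geodesic_word_def)
  moreover have "wlen (prod_list u) \<le> length u" "wlen (prod_list v) \<le> length v"
    using calculation wlen_le by auto
  ultimately show "geod u" "geod v"
    using wlen_mult[of "prod_list u" "prod_list v"] by (auto simp: geodesic_word_def)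
qed

lemma geod_take: "geod w \<Longrightarrow> geod (take i w)"
  using geod_append(1)[of "take i w" "drop i w"] by simp

lemma geod_drop: "geod w \<Longrightarrow> geod (drop i w)"
  using geod_append(2)[of "take i w" "drop i w"] by simp

lemma wlen_prefix: "geod w \<Longrightarrow> i \<le> length w \<Longrightarrow> wlen (prefix_prod w i) = i"
  using geod_length[OF geod_take, of w i] by simp

lemma wlen_suffix: "geod w \<Longrightarrow> wlen (suffix_prod w i) = length w - i"
  using geod_length[OF geod_drop, of w i] by simp

lemma ex_short_word: "wlen s \<le> n \<Longrightarrow> \<exists>w. set w \<subseteq> B \<and> length w \<le> n \<and> prod_list w = s"
  using ex_geod[of s] by (auto simp: geodesic_word_def)

lemma finite_ball: "finite {s. wlen s \<le> n}"
proof (rule finite_subset)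
  show "{s. wlen s \<le> n} \<subseteq> prod_list ` {w. set w \<subseteq> B \<and> length w \<le> n}"
    using ex_short_word by blast
  show "finite (prod_list ` {w. set w \<subseteq> B \<and> length w \<le> n})"
    using gen by (auto simp: fin_gen_set_def intro: finite_lists_length_le)
qed

text \<open>Replaces distances by right multiplication with elements of a finite ball. If
  \<open>v\<close> is unreachable, the infimum is over the empty set and hence infinite.\<close>

lemma cay_dist_le_iff: "cay_dist B u v \<le> enat n \<longleftrightarrow> (\<exists>s. wlen s \<le> n \<and> u * s = v)"
proof
  let ?W = "{w. set w \<subseteq> B \<and> u * prod_list w = v}"
  assume le: "cay_dist B u v \<le> enat n"
  have "?W \<noteq> {}"
  proof
    assume "?W = {}"
    then have "cay_dist B u v = \<infinity>" unfolding cay_dist_def by (simp only:) (simp add: top_enat_def)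
    then show False using le by simp
  qed
  then have "cay_dist B u v \<in> (\<lambda>w. enat (length w)) ` ?W"
    unfolding cay_dist_def Inf_enat_def
    using LeastI_ex[of "\<lambda>x. x \<in> (\<lambda>w. enat (length w)) ` ?W"] by auto
  then obtain w where w: "set w \<subseteq> B" "u * prod_list w = v" "cay_dist B u v = enat (length w)" by blast
  then have "wlen (prod_list w) \<le> n" using le wlen_le[of w] by simp
  then show "\<exists>s. wlen s \<le> n \<and> u * s = v" using w by blast
next
  assume "\<exists>s. wlen s \<le> n \<and> u * s = v"
  then obtain w where "set w \<subseteq> B" "length w \<le> n" "u * prod_list w = v" using ex_short_word by blast
  then show "cay_dist B u v \<le> enat n"
    unfolding cay_dist_def by (intro INF_lower2[of w]) auto
qed

text \<open>By left cancellation every path from \<open>x\<close> to \<open>x * prod_list w\<close>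
  spells a word for \<open>prod_list w\<close>, so distances do not depend on the base point
  \<open>x\<close>.\<close>

lemma cay_dist_geod: assumes "geod w" shows "cay_dist B x (x * prod_list w) = enat (length w)"
proof (rule antisym)
  show "cay_dist B x (x * prod_list w) \<le> enat (length w)"
    unfolding cay_dist_le_iff using geod_length[OF assms] by auto
  show "enat (length w) \<le> cay_dist B x (x * prod_list w)"
  proof (cases "cay_dist B x (x * prod_list w)")
    case (enat k)
    then obtain s where "wlen s \<le> k" "x * s = x * prod_list w"
      using cay_dist_le_iff[of x "x * prod_list w" k] by auto
    then show ?thesis using cancel enat geod_length[OF assms] by auto
  qed simp
qed

lemma cay_geodesic_word_path: assumes "geod w" shows "cay_geodesic B (word_path x w)"
proof -
  have "cay_edge B (x * prefix_prod w i) (x * prefix_prod w (Suc i))" if "i < length w" for i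
    using that geod_set[OF assms]
    by (auto simp: cay_edge_def take_Suc_conv_app_nth mult.assoc intro!: bexI[of _ "w ! i"])
  then have "cay_path B (word_path x w)"
    by (auto simp: cay_path_def word_path_def simp del: upt_Suc)
  then show ?thesis
    using cay_dist_geod[OF assms, of x]
    by (simp add: cay_geodesic_def word_path_ends) (simp add: word_path_def)
qed

section \<open>Thin triangles based at the identity\<close>

context
  fixes p q r :: "'m list"
  assumes geods: "geod p" "geod q" "geod r" and triangle: "prod_list p * prod_list q = prod_list r"
begin

lemma thin: "thin_triangle B \<delta> (word_path 1 p) (word_path (prod_list p) q) (word_path 1 r)"
proof -
  have "geod_triangle B (word_path 1 p) (word_path (prod_list p) q) (word_path 1 r)"
    unfolding geod_triangle_def using geods triangle
    by (auto simp: word_path_ends intro: cay_geodesic_word_path)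
  then show ?thesis using hyp unfolding strongly_hyperbolic_wrt_def by blast
qed

text \<open>The short element \<open>s\<close> always multiplies the start of the short path: a
  vertex of \<open>p\<close> in the out-ball case, the vertex of \<open>r\<close> itself in the
  in-ball case. The next two lemmas follow the same pattern for the other sides.\<close>

lemma thin_long_side:
  assumes "i \<le> length r"
  shows "(\<exists>j s. j \<le> length p \<and> wlen s \<le> \<delta> \<and> prefix_prod p j * s = prefix_prod r i) \<or>
    (\<exists>k s. k \<le> length q \<and> wlen s \<le> \<delta> \<and> prefix_prod r i * s = prod_list p * prefix_prod q k)"
proof -
  have "1 * prefix_prod r i \<in> set (word_path 1 r)" unfolding set_word_path using assms by blast
  then have "prefix_prod r i \<in> out_ball B \<delta> (set (word_path 1 p)) \<union> in_ball B \<delta> (set (word_path (prod_list p) q))"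
    using thin unfolding thin_triangle_def by auto
  then show ?thesis
    by (simp add: out_ball_def in_ball_def cay_dist_le_iff set_word_path) blast
qed

lemma thin_first_side:
  assumes "j \<le> length p"
  shows "(\<exists>i s. i \<le> length r \<and> wlen s \<le> \<delta> \<and> prefix_prod r i * s = prefix_prod p j) \<or>
    (\<exists>k s. k \<le> length q \<and> wlen s \<le> \<delta> \<and> prefix_prod p j * s = prod_list p * prefix_prod q k)"
proof -
  have "1 * prefix_prod p j \<in> set (word_path 1 p)" unfolding set_word_path using assms by blast
  then have "prefix_prod p j \<in> out_ball B \<delta> (set (word_path 1 r)) \<union> in_ball B \<delta> (set (word_path (prod_list p) q))"
    using thin unfolding thin_triangle_def by auto
  then show ?thesis
    by (simp add: out_ball_def in_ball_def cay_dist_le_iff set_word_path) blast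
qed

lemma thin_second_side:
  assumes "k \<le> length q"
  shows "(\<exists>j s. j \<le> length p \<and> wlen s \<le> \<delta> \<and> prefix_prod p j * s = prod_list p * prefix_prod q k) \<or>
    (\<exists>i s. i \<le> length r \<and> wlen s \<le> \<delta> \<and> prod_list p * prefix_prod q k * s = prefix_prod r i)"
proof -
  have "prod_list p * prefix_prod q k \<in> set (word_path (prod_list p) q)"
    unfolding set_word_path using assms by blast
  then have "prod_list p * prefix_prod q k \<in> out_ball B \<delta> (set (word_path 1 p)) \<union> in_ball B \<delta> (set (word_path 1 r))"
    using thin unfolding thin_triangle_def by auto
  then show ?thesis
    by (simp add: out_ball_def in_ball_def cay_dist_le_iff set_word_path) blast
qed

end

section \<open>Filling triangles by bounded relators\<close>

context
  fixes G :: "'m set" and D c :: nat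
  assumes BG: "B \<subseteq> G" and D: "2 * (c + \<delta>) + 2 \<le> D"
begin

lemma relator_step:
  "set u \<subseteq> B \<Longrightarrow> set v \<subseteq> B \<Longrightarrow> length u \<le> D \<Longrightarrow> length v \<le> D \<Longrightarrow> prod_list u = prod_list v \<Longrightarrow>
    rsteps (relators G D) 1 (p @ u @ s) (p @ v @ s)"
  by (rule rsteps_rule) (use BG in \<open>auto intro!: relatorsI\<close>)

text \<open>Far from its start, every vertex of \<open>p\<close> has a short path to the end of the triangle.
  Consecutive such paths differ by a bounded relator.\<close>

lemma fill_two_short_geodesics:
  assumes geods: "geod p" "geod q" "geod r" and short: "length q \<le> c" "length r \<le> c"
    and triangle: "prod_list p * prod_list q = prod_list r"
  shows "rsteps (relators G D) (length p + 2) (p @ q) r"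
proof -
  note sets = geod_set[OF geods(1)] geod_set[OF geods(2)] geod_set[OF geods(3)]
  have near: "\<exists>s. set s \<subseteq> B \<and> length s \<le> c + \<delta> \<and> prefix_prod p j * prod_list s = prod_list r"
    if j: "j \<le> length p" "c + \<delta> < j" for j
    using thin_first_side[OF geods triangle j(1)]
  proof (elim disjE exE conjE)
    fix i s assume "i \<le> length r" "wlen s \<le> \<delta>" "prefix_prod r i * s = prefix_prod p j"
    \<comment> \<open>The vertex has norm \<open>j\<close>, so a short path to it from the short
      side \<open>r\<close> contradicts \<open>c + \<delta> < j\<close>.\<close>
    then have "j \<le> i + \<delta>"
      using wlen_mult[of "prefix_prod r i" s] wlen_prefix[OF geods(1) j(1)] wlen_prefix[OF geods(3)] by simp
    then show ?thesis using \<open>i \<le> length r\<close> short(2) j(2) by simp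
  next
    fix k s assume k: "k \<le> length q" "wlen s \<le> \<delta>" "prefix_prod p j * s = prod_list p * prefix_prod q k"
    then obtain w where w: "set w \<subseteq> B" "length w \<le> \<delta>" "prod_list w = s" using ex_short_word by blast
    have "prefix_prod p j * prod_list (w @ drop k q) = prod_list r"
      using k(3) w(3) triangle prefix_suffix_prod[of k q] by (simp flip: mult.assoc) (simp add: mult.assoc)
    moreover have "set (w @ drop k q) \<subseteq> B" using w(1) sets(2) set_drop_subset[of k q] by auto
    moreover have "length (w @ drop k q) \<le> c + \<delta>" using w(2) short(1) by simp
    ultimately show ?thesis by blast
  qed
  have fill: "rsteps (relators G D) (n + 1) (p @ q) (take j p @ s)"
    if "j + n = length p" "c + \<delta> < j" "set s \<subseteq> B" "length s \<le> c + \<delta>"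
      "prefix_prod p j * prod_list s = prod_list r" for n j s
    using that
  proof (induction n arbitrary: j s)
    case 0
    then have "prod_list q = prod_list s" using triangle by (simp add: cancel[of "prod_list p"])
    then show ?case using relator_step[of q s p "[]"] 0 sets short D by simp
  next
    case (Suc n)
    obtain s' where s': "set s' \<subseteq> B" "length s' \<le> c + \<delta>" "prefix_prod p (Suc j) * prod_list s' = prod_list r"
      using near[of "Suc j"] Suc.prems by auto
    have IH: "rsteps (relators G D) (n + 1) (p @ q) (take (Suc j) p @ s')"
      by (rule Suc.IH) (use Suc.prems s' in auto)
    have j: "j < length p" using Suc.prems by simp
    then have tk: "take (Suc j) p = take j p @ [p ! j]" by (simp add: take_Suc_conv_app_nth)
    have "prefix_prod p j * (p ! j * prod_list s') = prefix_prod p j * prod_list s"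
      using s'(3) Suc.prems(5) unfolding tk by (simp add: mult.assoc)
    then have "prod_list (p ! j # s') = prod_list s" using cancel by simp
    then have "rsteps (relators G D) 1 (take j p @ (p ! j # s') @ []) (take j p @ s @ [])"
      by (intro relator_step) (use s' Suc.prems D j sets(1) in auto)
    then have "rsteps (relators G D) 1 (take (Suc j) p @ s') (take j p @ s)" unfolding tk by simp
    from rsteps_trans[OF IH this] show ?case by simp
  qed
  show ?thesis
  proof (cases "length p \<le> c + \<delta>")
    case True
    then show ?thesis
      using relator_step[of "p @ q" r "[]" "[]"] sets short D triangle by (auto intro: rsteps_mono)
  next
    case False
    \<comment> \<open>The first index to which \<open>near\<close> applies. The word
      \<open>take ?j p @ s\<close> may have length \<open>2 * (c + \<delta>) + 1\<close>, the
      longest relator side occurring here, which explains the bound on \<open>D\<close>.\<close>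
    let ?j = "Suc (c + \<delta>)"
    have j: "?j \<le> length p" using False by simp
    obtain s where s: "set s \<subseteq> B" "length s \<le> c + \<delta>" "prefix_prod p ?j * prod_list s = prod_list r"
      using near[OF j] by auto
    have 1: "rsteps (relators G D) (length p - ?j + 1) (p @ q) (take ?j p @ s)"
      by (rule fill) (use j s in auto)
    have "rsteps (relators G D) 1 ([] @ (take ?j p @ s) @ []) ([] @ r @ [])"
      by (rule relator_step) (use s sets short D set_take_subset[of ?j p] in auto)
    then have 2: "rsteps (relators G D) 1 (take ?j p @ s) r" by simp
    show ?thesis by (rule rsteps_trans_le[OF 1 2]) simp
  qed
qed

text \<open>Short words need not be geodesic; replacing each of the two by a geodesic costs one
  relator and does not exceed \<open>c\<close>.\<close>

lemma fill_two_short_sides: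
  assumes "geod p" "set q \<subseteq> B" "set r \<subseteq> B" "length q \<le> c" "length r \<le> c"
    and "prod_list p * prod_list q = prod_list r"
  shows "rsteps (relators G D) (length p + 4) (p @ q) r"
proof -
  obtain q' where q': "geod q'" "prod_list q' = prod_list q" using ex_geod by blast
  obtain r' where r': "geod r'" "prod_list r' = prod_list r" using ex_geod by blast
  have len: "length q' \<le> c" "length r' \<le> c"
    using wlen_le[of q] wlen_le[of r] assms geod_length q' r' by auto
  have 1: "rsteps (relators G D) 1 (p @ q) (p @ q')"
    using relator_step[of q q' p "[]"] q' geod_set len assms D by simp
  have 2: "rsteps (relators G D) (length p + 2) (p @ q') r'"
    by (rule fill_two_short_geodesics) (use assms q' r' len in auto)
  have 3: "rsteps (relators G D) 1 r' r"
    using relator_step[of r' r "[]" "[]"] r' geod_set len assms D by simp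
  show ?thesis by (rule rsteps_trans_le[OF rsteps_trans[OF 1 2] 3]) simp
qed

end

context
  fixes G :: "'m set" and D :: nat
  assumes BG: "B \<subseteq> G" and D: "6 * \<delta> + 6 \<le> D"
begin

text \<open>The value of \<open>c\<close> is the length of the longest short side used below:
  \<open>s @ drop i r\<close>, where \<open>s\<close> has at most \<open>\<delta>\<close> letters
  and \<open>drop i r\<close> has \<open>\<delta> + 2\<close>. Then
  \<open>2 * (c + \<delta>) + 2\<close> equals \<open>6 * \<delta> + 6\<close>.\<close>

lemmas fill_short = fill_two_short_sides[OF BG, where c = "2 * \<delta> + 2" and D = D]

text \<open>All but the last few vertices of \<open>r\<close> are reached by a short path from some
  vertex of \<open>p\<close>. The short paths to neighbouring vertices of \<open>r\<close> cut off
  triangles with one long side on \<open>p\<close> and two short sides; each is filled in linearly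
  many steps, and there are about \<open>length r\<close> of them.\<close>

lemma fill_triangle_letter:
  assumes geods: "geod p" "geod r" and b: "b \<in> B" and triangle: "prod_list p * b = prod_list r"
  shows "rsteps (relators G D) ((length r + 1) * (length p + 4)) (p @ [b]) r"
proof -
  have D': "2 * (2 * \<delta> + 2 + \<delta>) + 2 \<le> D" using D by simp
  note sets = geod_set[OF geods(1)] geod_set[OF geods(2)]
  obtain q where q: "geod q" "prod_list q = b" using ex_geod by blast
  have q1: "length q \<le> 1" using wlen_le[of "[b]"] b q geod_length by simp
  have tri: "prod_list p * prod_list q = prod_list r" using triangle q by simp
  have near: "\<exists>j s. j \<le> length p \<and> set s \<subseteq> B \<and> length s \<le> \<delta> \<and> prefix_prod p j * prod_list s = prefix_prod r i"
    if i: "i + \<delta> + 1 < length r" for i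
    using thin_long_side[OF geods(1) q(1) geods(2) tri less_imp_le[OF add_lessD1[OF add_lessD1[OF i]]]]
  proof (elim disjE exE conjE)
    fix j s assume "j \<le> length p" "wlen s \<le> \<delta>" "prefix_prod p j * s = prefix_prod r i"
    then show ?thesis using ex_short_word by blast
  next
    fix k s assume k: "k \<le> length q" "wlen s \<le> \<delta>" "prefix_prod r i * s = prod_list p * prefix_prod q k"
    have "prefix_prod r i * (s * suffix_prod q k) = prefix_prod r i * suffix_prod r i"
      using k(3) tri prefix_suffix_prod[of k q] prefix_suffix_prod[of i r]
      by (simp flip: mult.assoc) (simp add: mult.assoc)
    then have "suffix_prod r i = s * suffix_prod q k" using cancel by metis
    \<comment> \<open>Since \<open>q\<close> has at most one letter, a vertex with a short path to
      \<open>q\<close> has at most \<open>\<delta> + 1\<close> letters of \<open>r\<close> left.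
      These vertices belong to the last triangle, which is filled separately.\<close>
    then have "length r - i \<le> \<delta> + 1"
      using wlen_mult[of s "suffix_prod q k"] wlen_suffix[OF geods(2)] wlen_suffix[OF q(1)] k(2) q1
      by (metis add_mono diff_le_self le_trans)
    then show ?thesis using i by simp
  qed
  have fill: "rsteps (relators G D) ((i + 1) * (length p + 4)) (take j p @ s) (take i r)"
    if "i + \<delta> + 1 < length r" "j \<le> length p" "set s \<subseteq> B" "length s \<le> \<delta>"
      "prefix_prod p j * prod_list s = prefix_prod r i" for i j s
    using that
  proof (induction i arbitrary: j s)
    case 0
    have "rsteps (relators G D) (length (take j p) + 4) (take j p @ s) []"
      by (rule fill_short[OF D']) (use 0 geods in \<open>auto intro: geod_take\<close>)
    then show ?case using 0 by (auto intro: rsteps_mono)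
  next
    case (Suc i)
    let ?R = "relators G D"
    obtain j' s' where j': "j' \<le> length p" "set s' \<subseteq> B" "length s' \<le> \<delta>"
        "prefix_prod p j' * prod_list s' = prefix_prod r i"
      using near[of i] Suc.prems by auto
    have ri: "i < length r" "r ! i \<in> B" using Suc.prems sets by auto
    have tk: "take (Suc i) r = take i r @ [r ! i]" using ri by (simp add: take_Suc_conv_app_nth)
    have "rsteps ?R ((i + 1) * (length p + 4)) (take j' p @ s') (take i r)"
      by (rule Suc.IH) (use Suc.prems j' in auto)
    from rsteps_suffix[OF this, of "[r ! i]"]
    have IH: "rsteps ?R ((i + 1) * (length p + 4)) (take j' p @ s' @ [r ! i]) (take (Suc i) r)"
      unfolding tk by simp
    have prod: "prefix_prod p j' * prod_list (s' @ [r ! i]) = prefix_prod p j * prod_list s"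
      using j'(4) Suc.prems(5) unfolding tk by (simp flip: mult.assoc)
    have "rsteps ?R (length p + 4) (take j p @ s) (take j' p @ s' @ [r ! i])"
    \<comment> \<open>The starting points on \<open>p\<close> need not move monotonically with
      \<open>i\<close>. In the reversed order the triangle is filled from the other side, and
      symmetry of the relators turns the derivation around.\<close>
    proof (cases "j' \<le> j")
      case True
      define m where "m = drop j' (take j p)"
      have m: "take j p = take j' p @ m"
        using True unfolding m_def by (metis append_take_drop_id min.absorb1 take_take)
      have "geod m" unfolding m_def by (intro geod_drop geod_take geods)
      moreover have "prod_list m * prod_list s = prod_list (s' @ [r ! i])"
        using prod unfolding m by (simp add: mult.assoc cancel[of "prefix_prod p j'"])
      ultimately have "rsteps ?R (length m + 4) (m @ s) (s' @ [r ! i])"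
        by (intro fill_short[OF D']) (use Suc.prems j' ri in auto)
      from rsteps_prefix[OF this, of "take j' p"] show ?thesis
        unfolding m by (auto intro: rsteps_mono simp: m_def)
    next
      case False
      define m where "m = drop j (take j' p)"
      have m: "take j' p = take j p @ m"
        using False unfolding m_def by (metis append_take_drop_id min.absorb1 nat_le_linear take_take)
      have "geod m" unfolding m_def by (intro geod_drop geod_take geods)
      moreover have "prod_list m * prod_list (s' @ [r ! i]) = prod_list s"
        using prod unfolding m by (simp add: mult.assoc cancel[of "prefix_prod p j"])
      ultimately have "rsteps ?R (length m + 4) (m @ s' @ [r ! i]) s"
        by (intro fill_short[OF D']) (use Suc.prems j' ri in auto)
      from rsteps_symmetric[OF sym_relators rsteps_prefix[OF this, of "take j p"]] show ?thesis
        unfolding m by (auto intro: rsteps_mono simp: m_def)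
    qed
    from rsteps_trans[OF this IH] show ?case by simp
  qed
  show ?thesis
  proof (cases "length r \<le> \<delta> + 1")
    case True
    have "rsteps (relators G D) (length p + 4) (p @ [b]) r"
      by (rule fill_short[OF D']) (use True geods sets b triangle in auto)
    then show ?thesis by (rule rsteps_mono) simp
  next
    case False
    \<comment> \<open>The last vertex of \<open>r\<close> to which \<open>near\<close>
      applies.\<close>
    define i where "i = length r - (\<delta> + 2)"
    have i: "i + \<delta> + 1 < length r" "length r = i + \<delta> + 2" using False by (auto simp: i_def)
    obtain j s where j: "j \<le> length p" "set s \<subseteq> B" "length s \<le> \<delta>"
        "prefix_prod p j * prod_list s = prefix_prod r i"
      using near[OF i(1)] by blast
    have "prefix_prod p j * (suffix_prod p j * b) = prefix_prod p j * (prod_list s * suffix_prod r i)"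
      using triangle prefix_suffix_prod[of j p] prefix_suffix_prod[of i r] j(4) by (simp flip: mult.assoc)
    then have "suffix_prod p j * b = prod_list s * suffix_prod r i" by (rule cancel)
    then have "rsteps (relators G D) (length (drop j p) + 4) (drop j p @ [b]) (s @ drop i r)"
      by (intro fill_short[OF D'])
         (use geods sets b j i set_drop_subset[of i r] in \<open>auto intro: geod_drop\<close>)
    from rsteps_prefix[OF this, of "take j p"]
    have 1: "rsteps (relators G D) (length (drop j p) + 4) (p @ [b]) (take j p @ s @ drop i r)"
      by (simp flip: append_assoc)
    have 2: "rsteps (relators G D) ((i + 1) * (length p + 4)) (take j p @ s @ drop i r) r"
      using rsteps_suffix[OF fill[OF i(1) j], of "drop i r"] by simp
    have "(i + 2) * (length p + 4) \<le> (length r + 1) * (length p + 4)"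
      using i(2) by (intro mult_le_mono1) simp
    then show ?thesis
      by (intro rsteps_trans_le[OF 1 2]) (simp add: algebra_simps)
  qed
qed

text \<open>A geodesic for the prefix read so far is extended by one letter and straightened again.
  Each straightening is quadratic, so the total is cubic.\<close>

lemma rsteps_to_geodesic:
  assumes "set w \<subseteq> B" "geod g" "prod_list g = prod_list w"
  shows "rsteps (relators G D) (length w * ((length w + 1) * (length w + 4))) w g"
  using assms
proof (induction w arbitrary: g rule: rev_induct)
  case Nil
  then show ?case using geod_length[of g] wlen_one by (simp add: rsteps.refl)
next
  case (snoc b w)
  obtain p where p: "geod p" "prod_list p = prod_list w" using ex_geod by blast
  have len: "length p \<le> length w" "length g \<le> length w + 1"
    using wlen_le[of w] wlen_le[of "w @ [b]"] geod_length p snoc.prems by auto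
  let ?f = "\<lambda>n. (n + 1) * (n + 4)"
  have "rsteps (relators G D) (length w * ?f (length w)) w p"
    by (rule snoc.IH) (use snoc.prems p in auto)
  from rsteps_suffix[OF this, of "[b]"]
  have 1: "rsteps (relators G D) (length w * ?f (length w)) (w @ [b]) (p @ [b])" by simp
  have 2: "rsteps (relators G D) ((length g + 1) * (length p + 4)) (p @ [b]) g"
    by (rule fill_triangle_letter) (use snoc.prems p in auto)
  have "(length g + 1) * (length p + 4) \<le> ?f (Suc (length w))"
    using len by (intro mult_le_mono) auto
  moreover have "length w * ?f (length w) \<le> length w * ?f (Suc (length w))"
    by (intro mult_le_mono) auto
  ultimately have "length w * ?f (length w) + (length g + 1) * (length p + 4)
      \<le> length (w @ [b]) * ?f (length (w @ [b]))"
    unfolding length_append_singleton mult_Suc[of "length w"] by linarith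
  then show ?case by (rule rsteps_trans_le[OF 1 2])
qed

end


section \<open>Short solutions of \<open>x = a y b\<close>\<close>

text \<open>The bound counts the vertices of a geodesic \<open>wa\<close> for \<open>a\<close>:
  those at distance at most \<open>wlen x + 2 * \<delta>\<close> from 1, at most \<open>I\<close>
  for each vertex of \<open>y\<close> and each short element, and at most one for each pair of short
  elements.\<close>

lemma minimal_left_factor_bound:
  assumes T: "factor_closed T"
    and I: "\<And>s g. wlen s \<le> \<delta> \<Longrightarrow> finite {z. z * s = g} \<and> card {z. z * s = g} \<le> I"
    and a: "a \<in> T" "b \<in> T" "x = a * y * b"
    and minimal: "\<And>a' b'. a' \<in> T \<Longrightarrow> b' \<in> T \<Longrightarrow> x = a' * y * b' \<Longrightarrow> wlen a \<le> wlen a'"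
    and \<beta>: "\<beta> = card {s. wlen s \<le> \<delta>}"
  shows "wlen a \<le> wlen x + 2 * \<delta> + \<beta> * \<beta> + (wlen y + 1) * (\<beta> * I)"
proof -
  let ?Ball = "{s. wlen s \<le> \<delta>}"
  obtain wa where wa: "geod wa" "prod_list wa = a" using ex_geod by blast
  obtain wb where wb: "geod wb" "prod_list wb = b" using ex_geod by blast
  obtain wx where wx: "geod wx" "prod_list wx = x" using ex_geod by blast
  obtain wy where wy: "geod wy" "prod_list wy = y" using ex_geod by blast
  obtain t where t: "geod t" "prod_list t = a * y" using ex_geod by blast
  let ?P = "prefix_prod wa"
  \<comment> \<open>The diagonal \<open>t\<close> splits the quadrilateral into two triangles.
    \<open>L1\<close> holds the vertices of \<open>wa\<close> with a short path to the side
    \<open>y\<close>. The others are reached by a short \<open>\<alpha>\<close> from a vertex of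
    \<open>t\<close>; they are in \<open>L2 (\<alpha>, \<gamma>)\<close> if \<open>\<gamma>\<close>
    leads from that vertex of \<open>t\<close> to the side \<open>b\<close>.\<close>
  define L1 where "L1 = (\<Union>k\<le>length wy. \<Union>s\<in>?Ball. {l. l \<le> length wa \<and> ?P l * s = a * prefix_prod wy k})"
  define L2 where "L2 = (\<lambda>(\<alpha>, \<gamma>). {l. l \<le> length wa \<and>
    (\<exists>j k. prefix_prod t j * \<alpha> = ?P l \<and> prefix_prod t j * \<gamma> = a * y * prefix_prod wb k)})"
  have cover: "{..length wa} \<subseteq> {..wlen x + 2 * \<delta>} \<union> L1 \<union> (\<Union>p\<in>?Ball \<times> ?Ball. L2 p)"
  proof
    fix l assume "l \<in> {..length wa}"
    then have l: "l \<le> length wa" by simp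
    have "prod_list wa * prod_list wy = prod_list t" using wa wy t by simp
    from thin_first_side[OF wa(1) wy(1) t(1) this l]
    show "l \<in> {..wlen x + 2 * \<delta>} \<union> L1 \<union> (\<Union>p\<in>?Ball \<times> ?Ball. L2 p)"
    proof (elim disjE exE conjE)
      fix k s assume "k \<le> length wy" "wlen s \<le> \<delta>" "?P l * s = prod_list wa * prefix_prod wy k"
      then have "l \<in> L1" unfolding L1_def using l wa(2) by auto
      then show ?thesis by blast
    next
      fix j \<alpha> assume j: "j \<le> length t" "wlen \<alpha> \<le> \<delta>" "prefix_prod t j * \<alpha> = ?P l"
      have "prod_list t * prod_list wb = prod_list wx" using t wb wx a by simp
      from thin_first_side[OF t(1) wb(1) wx(1) this j(1)] show ?thesis
      proof (elim disjE exE conjE)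
        fix i s assume i: "i \<le> length wx" "wlen s \<le> \<delta>" "prefix_prod wx i * s = prefix_prod t j"
        have "l \<le> j + \<delta>"
          using wlen_mult[of "prefix_prod t j" \<alpha>] j wlen_prefix[OF t(1) j(1)] wlen_prefix[OF wa(1) l] by simp
        moreover have "j \<le> i + \<delta>"
          using wlen_mult[of "prefix_prod wx i" s] i wlen_prefix[OF t(1) j(1)] wlen_prefix[OF wx(1) i(1)] by simp
        moreover have "i \<le> wlen x" using i(1) geod_length[OF wx(1)] wx(2) by simp
        ultimately show ?thesis by simp
      next
        fix k \<gamma> assume "k \<le> length wb" "wlen \<gamma> \<le> \<delta>" "prefix_prod t j * \<gamma> = prod_list t * prefix_prod wb k"
        then have "(\<alpha>, \<gamma>) \<in> ?Ball \<times> ?Ball" "l \<in> L2 (\<alpha>, \<gamma>)"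
          unfolding L2_def using l j t(2) by auto
        then show ?thesis by blast
      qed
    qed
  qed
  have inj: "inj_on ?P {..length wa}"
    by (rule inj_onI) (metis atMost_iff wlen_prefix[OF wa(1)])
  have "card {l. l \<le> length wa \<and> ?P l * s = g} \<le> I" if "wlen s \<le> \<delta>" for s g
  proof -
    have "inj_on ?P {l. l \<le> length wa \<and> ?P l * s = g}" by (rule inj_on_subset[OF inj]) auto
    moreover have "?P ` {l. l \<le> length wa \<and> ?P l * s = g} \<subseteq> {z. z * s = g}" by auto
    ultimately have "card {l. l \<le> length wa \<and> ?P l * s = g} \<le> card {z. z * s = g}"
      using I[OF that, of g] by (intro card_inj_on_le) auto
    also have "\<dots> \<le> I" using I[OF that] by blast
    finally show ?thesis .
  qed
  then have "card L1 \<le> card {..length wy} * (\<beta> * I)"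
    unfolding L1_def \<beta> by (intro card_UN_bound finite_ball) auto
  then have L1: "card L1 \<le> (wlen y + 1) * (\<beta> * I)" using geod_length[OF wy(1)] wy(2) by simp
  text \<open>Two vertices of \<open>wa\<close> with the same pair \<open>(\<alpha>, \<gamma>)\<close> would allow us to cut out the part
    of \<open>wa\<close> between them, at the price of changing \<open>b\<close>.\<close>
  have L2_less: False if "l \<in> L2 (\<alpha>, \<gamma>)" "l' \<in> L2 (\<alpha>, \<gamma>)" "l < l'" for \<alpha> \<gamma> l l'
  proof -
    obtain j k where jk: "prefix_prod t j * \<alpha> = ?P l" "prefix_prod t j * \<gamma> = a * y * prefix_prod wb k"
      using \<open>l \<in> _\<close> unfolding L2_def by auto
    obtain j' k' where jk': "prefix_prod t j' * \<alpha> = ?P l'" "prefix_prod t j' * \<gamma> = a * y * prefix_prod wb k'"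
      and l': "l' \<le> length wa"
      using \<open>l' \<in> _\<close> unfolding L2_def by auto
    let ?a = "?P l * suffix_prod wa l'" and ?b = "prefix_prod wb k' * suffix_prod wb k"
    \<comment> \<open>From the vertex \<open>j'\<close> of \<open>t\<close>, the element
      \<open>\<gamma>\<close> is also spelled by the detour over \<open>\<alpha>\<close>, the rest
      of \<open>wa\<close> after \<open>l'\<close>, \<open>y\<close>, and \<open>wb\<close> up to
      \<open>k'\<close>. From the vertex \<open>j\<close> the same \<open>\<gamma>\<close> leads to
      position \<open>k\<close> of \<open>wb\<close>, so the detour can start at \<open>l\<close>,
      skipping the letters of \<open>wa\<close> between \<open>l\<close> and
      \<open>l'\<close>.\<close>
    have "prefix_prod t j' * (\<alpha> * suffix_prod wa l' * y * prefix_prod wb k') = prefix_prod t j' * \<gamma>"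
      unfolding jk'(2) using jk'(1) prefix_suffix_prod[of l' wa] wa(2) by (simp flip: mult.assoc)
    then have \<gamma>: "\<alpha> * suffix_prod wa l' * y * prefix_prod wb k' = \<gamma>" by (rule cancel)
    have "x = a * y * prefix_prod wb k * suffix_prod wb k"
      using a(3) prefix_suffix_prod[of k wb] wb(2) by (simp add: mult.assoc)
    also have "\<dots> = prefix_prod t j * (\<alpha> * suffix_prod wa l' * y * prefix_prod wb k') * suffix_prod wb k"
      unfolding \<gamma> jk(2) ..
    also have "\<dots> = ?a * y * ?b" using jk(1) by (simp flip: mult.assoc)
    finally have x: "x = ?a * y * ?b" .
    have "?P l \<in> T" "suffix_prod wa l' \<in> T" "prefix_prod wb k' \<in> T" "suffix_prod wb k \<in> T"
      using T a(1,2) unfolding wa(2)[symmetric] wb(2)[symmetric] factor_closed_def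
      by (metis prefix_suffix_prod)+
    then have "?a \<in> T" "?b \<in> T" using T unfolding factor_closed_def by auto
    from minimal[OF this x] have "wlen a \<le> wlen (?P l) + wlen (suffix_prod wa l')"
      by (rule le_trans) (rule wlen_mult)
    then have "length wa \<le> l + (length wa - l')"
      using wlen_prefix[OF wa(1), of l] wlen_suffix[OF wa(1), of l'] that(3) l' geod_length[OF wa(1)] wa(2) by simp
    then show False using that(3) l' by simp
  qed
  have "card (L2 p) \<le> 1" for p
  proof -
    obtain \<alpha> \<gamma> where p: "p = (\<alpha>, \<gamma>)" by (cases p)
    have "finite (L2 p)" unfolding L2_def p by (auto intro: finite_subset[of _ "{..length wa}"])
    moreover have "l = l'" if "l \<in> L2 p" "l' \<in> L2 p" for l l'
      using L2_less[of _ \<alpha> \<gamma>] that unfolding p by (metis nat_neq_iff)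
    ultimately show ?thesis by (simp add: card_le_Suc0_iff_eq)
  qed
  then have "card (\<Union>p\<in>?Ball \<times> ?Ball. L2 p) \<le> card (?Ball \<times> ?Ball) * 1"
    by (intro card_UN_bound finite_cartesian_product finite_ball)
  then have L2: "card (\<Union>p\<in>?Ball \<times> ?Ball. L2 p) \<le> \<beta> * \<beta>" by (simp add: card_cartesian_product \<beta>)
  have fin: "finite L1" "finite (\<Union>p\<in>?Ball \<times> ?Ball. L2 p)"
    by (rule finite_subset[of _ "{..length wa}"]; auto simp: L1_def L2_def)+
  have "card {..length wa} \<le> card ({..wlen x + 2 * \<delta>} \<union> L1 \<union> (\<Union>p\<in>?Ball \<times> ?Ball. L2 p))"
    by (rule card_mono[OF _ cover]) (use fin in simp)
  also have "\<dots> \<le> card {..wlen x + 2 * \<delta>} + card L1 + card (\<Union>p\<in>?Ball \<times> ?Ball. L2 p)"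
    by (meson add_mono card_Un_le le_refl le_trans)
  also have "\<dots> \<le> (wlen x + 2 * \<delta> + 1) + (wlen y + 1) * (\<beta> * I) + \<beta> * \<beta>"
    using L1 L2 by (intro add_mono) auto
  finally show ?thesis using geod_length[OF wa(1)] wa(2) by simp
qed

text \<open>Left cancellation replaces minimality: the vertices \<open>z * prefix_prod wb k\<close>
  are distinct, so each point reached from the geodesic \<open>t\<close> by a short element occurs
  at most once. Any other vertex has a short path to \<open>x\<close>'s side and so lies within
  \<open>wlen x + \<delta>\<close> of the end of \<open>wb\<close>.\<close>

lemma right_factor_bound:
  assumes x: "x = z * b" and \<beta>: "\<beta> = card {s. wlen s \<le> \<delta>}"
  shows "wlen b \<le> wlen x + \<delta> + (wlen z + 1) * \<beta>"
proof -
  let ?Ball = "{s. wlen s \<le> \<delta>}"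
  obtain wb where wb: "geod wb" "prod_list wb = b" using ex_geod by blast
  obtain wx where wx: "geod wx" "prod_list wx = x" using ex_geod by blast
  obtain t where t: "geod t" "prod_list t = z" using ex_geod by blast
  define L where "L = (\<Union>j\<le>length t. \<Union>s\<in>?Ball. {k. k \<le> length wb \<and> prefix_prod t j * s = z * prefix_prod wb k})"
  have cover: "{..length wb} \<subseteq> {length wb - (wlen x + \<delta>)..length wb} \<union> L"
  proof
    fix k assume "k \<in> {..length wb}"
    then have k: "k \<le> length wb" by simp
    have "prod_list t * prod_list wb = prod_list wx" using t wb wx x by simp
    from thin_second_side[OF t(1) wb(1) wx(1) this k]
    show "k \<in> {length wb - (wlen x + \<delta>)..length wb} \<union> L"
    proof (elim disjE exE conjE)
      fix j s assume "j \<le> length t" "wlen s \<le> \<delta>" "prefix_prod t j * s = prod_list t * prefix_prod wb k"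
      then have "k \<in> L" unfolding L_def using k t(2) by auto
      then show ?thesis by blast
    next
      fix i s assume i: "i \<le> length wx" "wlen s \<le> \<delta>" "prod_list t * prefix_prod wb k * s = prefix_prod wx i"
      have "z * prefix_prod wb k * (s * suffix_prod wx i) = z * prefix_prod wb k * suffix_prod wb k"
        using i(3) t(2) prefix_suffix_prod[of i wx] prefix_suffix_prod[of k wb] wx(2) wb(2) x
        by (simp flip: mult.assoc) (simp add: mult.assoc)
      from cancel[OF this] have "wlen (suffix_prod wb k) \<le> wlen s + wlen (suffix_prod wx i)"
        using wlen_mult by metis
      then have "length wb - k \<le> \<delta> + (length wx - i)"
        using wlen_suffix[OF wb(1)] wlen_suffix[OF wx(1)] i(2) by simp
      then have "length wb - (wlen x + \<delta>) \<le> k" using geod_length[OF wx(1)] wx(2) by simp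
      then show ?thesis using k by simp
    qed
  qed
  have "card {k. k \<le> length wb \<and> g = z * prefix_prod wb k} \<le> 1" for g
  proof -
    have "k = k'" if "k \<le> length wb" "k' \<le> length wb" "z * prefix_prod wb k = z * prefix_prod wb k'" for k k'
      using cancel[OF that(3)] wlen_prefix[OF wb(1)] that by metis
    then show ?thesis
      by (simp add: card_le_Suc0_iff_eq)
  qed
  then have "card L \<le> card {..length t} * (\<beta> * 1)"
    unfolding L_def \<beta> by (intro card_UN_bound finite_ball) auto
  then have L: "card L \<le> (wlen z + 1) * \<beta>" using geod_length[OF t(1)] t(2) by simp
  have "finite L" by (rule finite_subset[of _ "{..length wb}"]) (auto simp: L_def)
  have "card {..length wb} \<le> card ({length wb - (wlen x + \<delta>)..length wb} \<union> L)"
    by (rule card_mono[OF _ cover]) (use \<open>finite L\<close> in simp)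
  also have "\<dots> \<le> card {length wb - (wlen x + \<delta>)..length wb} + card L" by (rule card_Un_le)
  also have "\<dots> \<le> (wlen x + \<delta> + 1) + (wlen z + 1) * \<beta>" using L by (intro add_mono) auto
  finally show ?thesis using geod_length[OF wb(1)] wb(2) by simp
qed

lemma linear_bound_two_sided_factors:
  assumes T: "factor_closed T" and "bounded_indegree TYPE('m)"
  shows "\<exists>C. \<forall>x y. (\<exists>a\<in>T. \<exists>b\<in>T. x = a * y * b) \<longrightarrow>
    (\<exists>a\<in>T. \<exists>b\<in>T. x = a * y * b \<and> wlen a \<le> C * (wlen x + wlen y + 1) \<and> wlen b \<le> C * (wlen x + wlen y + 1))"
proof -
  obtain I where I: "\<And>s g. wlen s \<le> \<delta> \<Longrightarrow> finite {z. z * s = g} \<and> card {z. z * s = g} \<le> I"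
    using bounded_indegree_card_uniform[OF assms(2) finite_ball[of \<delta>]] by auto
  define \<beta> where "\<beta> = card {s. wlen s \<le> \<delta>}"
  define C1 where "C1 = 1 + 2 * \<delta> + \<beta> * \<beta> + \<beta> * I"
  define C where "C = C1 + (1 + \<delta> + (C1 + 1) * \<beta>)"
  have "\<exists>a\<in>T. \<exists>b\<in>T. x = a * y * b \<and> wlen a \<le> C * (wlen x + wlen y + 1) \<and> wlen b \<le> C * (wlen x + wlen y + 1)"
    if ex: "\<exists>a\<in>T. \<exists>b\<in>T. x = a * y * b" for x y
  proof -
    let ?N = "wlen x + wlen y + 1"
    let ?S = "\<lambda>a. a \<in> T \<and> (\<exists>b\<in>T. x = a * y * b)"
    \<comment> \<open>The minimum ranges over all left factors with any matching \<open>b\<close>,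
      because cutting a piece out of \<open>a\<close> changes \<open>b\<close>.\<close>
    define a where "a = arg_min wlen ?S"
    obtain a0 where "?S a0" using ex by blast
    from arg_min_nat_lemma[of ?S, OF this, of wlen] have a: "?S a" "\<And>a'. ?S a' \<Longrightarrow> wlen a \<le> wlen a'"
      unfolding a_def by auto
    then obtain b where b: "b \<in> T" "x = a * y * b" by blast
    have N: "k \<le> k * ?N" for k by simp
    have "wlen a \<le> wlen x + 2 * \<delta> + \<beta> * \<beta> + (wlen y + 1) * (\<beta> * I)"
      by (rule minimal_left_factor_bound[OF T I]) (use a b \<beta>_def in blast)+
    also have "\<dots> \<le> 1 * ?N + 2 * \<delta> * ?N + \<beta> * \<beta> * ?N + \<beta> * I * ?N"
    proof (intro add_mono)
      show "(wlen y + 1) * (\<beta> * I) \<le> \<beta> * I * ?N" by (subst mult.commute) (intro mult_le_mono2, simp)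
    qed (simp, rule N, rule N)
    also have "\<dots> = C1 * ?N" by (simp only: C1_def distrib_right)
    finally have 1: "wlen a \<le> C1 * ?N" .
    have "wlen b \<le> wlen x + \<delta> + (wlen (a * y) + 1) * \<beta>"
      by (rule right_factor_bound[OF b(2) \<beta>_def])
    also have "\<dots> \<le> 1 * ?N + \<delta> * ?N + ((C1 + 1) * ?N) * \<beta>"
    proof (intro add_mono mult_le_mono1)
      show "wlen (a * y) + 1 \<le> (C1 + 1) * ?N"
        using 1 wlen_mult[of a y] by (simp add: distrib_right)
    qed (simp, rule N)
    also have "\<dots> = (1 + \<delta> + (C1 + 1) * \<beta>) * ?N" by (simp add: algebra_simps)
    finally have 2: "wlen b \<le> (1 + \<delta> + (C1 + 1) * \<beta>) * ?N" .
    have "wlen a \<le> C * ?N" "wlen b \<le> C * ?N"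
      using 1 2 unfolding C_def distrib_right[of C1] by linarith+
    with a b show ?thesis by blast
  qed
  then show ?thesis by blast
qed

end

section \<open>Deciding \<open>x = a y b\<close> by rewriting\<close>

definition two_sided_factor :: "'m::monoid_mult set \<Rightarrow> 'm \<Rightarrow> 'm \<Rightarrow> bool" where
  "two_sided_factor T x y \<longleftrightarrow> (\<exists>a\<in>T. \<exists>b\<in>T. x = a * y * b)"

abbreviation letter :: "'m \<Rightarrow> 'm option + nat" where
  "letter m \<equiv> Inl (Some m)"

abbreviation separator :: "'m option + nat" where
  "separator \<equiv> Inl None"

text \<open>The symbol \<open>Inr (i + 5)\<close> is a travelling copy of the letter \<open>Bs ! i\<close>: it leaves the first word
  through the separator, crosses the second word and is cancelled at its end. The end marker \<open>Inr 2\<close>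
  is replaced by \<open>Inr 4\<close> before that, because letters must not be appended after a cancellation.
  Relators are applied only to the right of a symbol, so that nothing is ever inserted outside of
  the end markers.\<close>

definition comparison_rules ::
  "'m::monoid_mult set \<Rightarrow> nat \<Rightarrow> 'm set \<Rightarrow> 'm list \<Rightarrow> (('m option + nat) list \<times> ('m option + nat) list) set"
where
  "comparison_rules G D T Bs =
     (\<lambda>(c, u, v). (c # map letter u, c # map letter v)) `
       (insert (Inr 1) (insert separator (letter ` G)) \<times> relators G D) \<union>
     (\<lambda>b. ([separator], [separator, letter b])) ` (set Bs \<inter> T) \<union>
     (\<lambda>b. ([Inr 2], [letter b, Inr 2])) ` (set Bs \<inter> T) \<union>
     {([Inr 2], [Inr 4])} \<union>
     (\<lambda>i. ([letter (Bs ! i), separator], [separator, Inr (i + 5)])) ` {..<length Bs} \<union>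
     (\<lambda>(i, b). ([Inr (i + 5), letter b], [letter b, Inr (i + 5)])) ` ({..<length Bs} \<times> set Bs) \<union>
     (\<lambda>i. ([letter (Bs ! i), Inr (i + 5), Inr 4], [Inr 4])) ` {..<length Bs} \<union>
     {([Inr 1, separator, Inr 4], [Inr 3])}"

subsection \<open>Soundness\<close>

text \<open>An automaton that evaluates tape words. In state \<open>Rgt x v\<close> the travelling letters have
  already been multiplied onto \<open>x\<close>; words with several separators lead to \<open>Junk\<close>. The two end markers
  lead to \<open>Done x v\<close> and \<open>LDone x v\<close>; in the latter case only a left factor may be missing in \<open>v\<close>.\<close>

datatype 'm scan = Start | Lft 'm | Rgt 'm 'm | Junk | Done 'm 'm | LDone 'm 'm | JunkDone | Bad

fun scan_step :: "'m::monoid_mult list \<Rightarrow> 'm scan \<Rightarrow> 'm option + nat \<Rightarrow> 'm scan" where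
  "scan_step Bs Start s =
     (case s of Inl _ \<Rightarrow> Bad | Inr n \<Rightarrow> if n = 1 then Lft 1 else if n = 3 then LDone 1 1 else Bad)"
| "scan_step Bs (Lft x) s =
     (case s of Inl None \<Rightarrow> Rgt x 1 | Inl (Some a) \<Rightarrow> Lft (x * a)
      | Inr n \<Rightarrow> if n = 2 \<or> n = 4 then JunkDone else if n < 5 then Bad else Junk)"
| "scan_step Bs (Rgt x v) s =
     (case s of Inl None \<Rightarrow> Junk | Inl (Some a) \<Rightarrow> Rgt x (v * a)
      | Inr n \<Rightarrow> if n = 2 then Done x v else if n = 4 then LDone x v else if n < 5 then Bad
         else Rgt (x * Bs ! (n - 5)) v)"
| "scan_step Bs Junk s =
     (case s of Inl _ \<Rightarrow> Junk | Inr n \<Rightarrow> if n = 2 \<or> n = 4 then JunkDone else if n < 5 then Bad else Junk)"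
| "scan_step Bs (Done x v) s = Bad"
| "scan_step Bs (LDone x v) s = Bad"
| "scan_step Bs JunkDone s = Bad"
| "scan_step Bs Bad s = Bad"

fun scan_good :: "'m::monoid_mult set \<Rightarrow> 'm scan \<Rightarrow> bool" where
  "scan_good T (Done x v) \<longleftrightarrow> two_sided_factor T x v"
| "scan_good T (LDone x v) \<longleftrightarrow> (\<exists>a\<in>T. x = a * v)"
| "scan_good T _ \<longleftrightarrow> False"

fun scan_final :: "'m scan \<Rightarrow> bool" where
  "scan_final (Done x v) \<longleftrightarrow> True"
| "scan_final (LDone x v) \<longleftrightarrow> True"
| "scan_final _ \<longleftrightarrow> False"

text \<open>Compares the states before (\<open>s\<close>) and after (\<open>s'\<close>) a rule, so
  that goodness passes backwards from acceptance. An insertion behind the separator changes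
  \<open>v\<close> on its left, and this difference persists up to the end marker; rules at the
  right end change only final states, where goodness is all that counts.\<close>

definition scan_le :: "'m::monoid_mult set \<Rightarrow> 'm scan \<Rightarrow> 'm scan \<Rightarrow> bool" where
  "scan_le T s s' \<longleftrightarrow> s = s' \<or> (\<exists>x v b. b \<in> T \<and> s = Rgt x v \<and> s' = Rgt x (b * v)) \<or>
     (scan_final s \<and> scan_final s' \<and> (scan_good T s' \<longrightarrow> scan_good T s))"

lemma two_sided_factor_left:
  assumes "factor_closed T" "b \<in> T" "two_sided_factor T x (b * v)" shows "two_sided_factor T x v"
proof -
  obtain a c where "a \<in> T" "c \<in> T" "x = a * (b * v) * c"
    using assms(3) unfolding two_sided_factor_def by blast
  then have "a * b \<in> T" "x = a * b * v * c" using assms unfolding factor_closed_def by (auto simp: mult.assoc)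
  then show ?thesis using \<open>c \<in> T\<close> unfolding two_sided_factor_def by blast
qed

lemma two_sided_factor_right:
  assumes "factor_closed T" "b \<in> T" "two_sided_factor T x (v * b)" shows "two_sided_factor T x v"
proof -
  obtain a c where "a \<in> T" "c \<in> T" "x = a * (v * b) * c"
    using assms(3) unfolding two_sided_factor_def by blast
  then have "b * c \<in> T" "x = a * v * (b * c)" using assms unfolding factor_closed_def by (auto simp: mult.assoc)
  then show ?thesis using \<open>a \<in> T\<close> unfolding two_sided_factor_def by blast
qed

text \<open>Later symbols multiply \<open>x\<close> and \<open>v\<close> on the right and leave the
  additional left factor \<open>b\<close> alone; at the end marker \<open>b\<close> is absorbed into
  the missing left factor.\<close>

lemma scan_le_step:
  assumes T: "factor_closed T" and "scan_le T s s'"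
  shows "scan_le T (scan_step Bs s c) (scan_step Bs s' c)"
proof -
  consider "s = s'" | x v b where "b \<in> T" "s = Rgt x v" "s' = Rgt x (b * v)"
    | "scan_final s" "scan_final s'"
    using assms(2) unfolding scan_le_def by blast
  then show ?thesis
  proof cases
    case (2 x v b)
    have "\<exists>a'\<in>T. a * (b * v) = a' * v" if "a \<in> T" for a
      using that 2(1) T unfolding factor_closed_def by (metis mult.assoc)
    then show ?thesis
      using 2 two_sided_factor_left[OF T 2(1)]
      by (auto simp: scan_le_def mult.assoc split: sum.split option.split)
  next
    case 3
    then show ?thesis by (cases s; cases s') (auto simp: scan_le_def)
  qed (auto simp: scan_le_def)
qed

lemma scan_le_foldl:
  "factor_closed T \<Longrightarrow> scan_le T s s' \<Longrightarrow>
    scan_le T (foldl (scan_step Bs) s w) (foldl (scan_step Bs) s' w)"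
  by (induction w arbitrary: s s') (auto intro: scan_le_step)

lemma foldl_scan_letters:
  "foldl (scan_step Bs) (Lft x) (map letter u) = Lft (x * prod_list u)"
  "foldl (scan_step Bs) (Rgt x v) (map letter u) = Rgt x (v * prod_list u)"
  "foldl (scan_step Bs) Junk (map letter u) = Junk"
  by (induction u arbitrary: x v) (auto simp: mult.assoc)

lemma foldl_scan_Bad: "foldl (scan_step Bs) Bad w = Bad"
  by (induction w) auto

lemma scan_le_rule:
  assumes T: "factor_closed T" and "(l, r) \<in> comparison_rules G D T Bs"
  shows "scan_le T (foldl (scan_step Bs) s l) (foldl (scan_step Bs) s r)"
proof -
  consider c u v where "c = Inr 1 \<or> c = separator \<or> c \<in> letter ` G" "(u, v) \<in> relators G D"
      "l = c # map letter u" "r = c # map letter v"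
    | b where "b \<in> T" "l = [separator]" "r = [separator, letter b]"
    | b where "b \<in> T" "l = [Inr 2]" "r = [letter b, Inr 2]"
    | "l = [Inr 2]" "r = [Inr 4]"
    | i where "l = [letter (Bs ! i), separator]" "r = [separator, Inr (i + 5)]"
    | i b where "l = [Inr (i + 5), letter b]" "r = [letter b, Inr (i + 5)]"
    | i where "l = [letter (Bs ! i), Inr (i + 5), Inr 4]" "r = [Inr 4]"
    | "l = [Inr 1, separator, Inr 4]" "r = [Inr 3]"
    using assms(2) unfolding comparison_rules_def by (elim UnE) auto
  then show ?thesis
  proof cases
    case (1 c u v)
    have "prod_list u = prod_list v" using 1(2) by (simp add: relators_def)
    moreover have "scan_step Bs s c = Bad \<or> scan_step Bs s c = Junk \<or> (\<exists>x. scan_step Bs s c = Lft x) \<or>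
        (\<exists>x v. scan_step Bs s c = Rgt x v)"
      using 1(1) by (cases s) auto
    ultimately have "foldl (scan_step Bs) s l = foldl (scan_step Bs) s r"
      unfolding 1(3,4) by (auto simp: foldl_scan_letters foldl_scan_Bad)
    then show ?thesis by (simp add: scan_le_def)
  next
    case (2 b)
    then show ?thesis by (cases s) (auto simp: scan_le_def)
  next
    case (3 b)
    then show ?thesis using two_sided_factor_right[OF T 3(1)]
      by (cases s) (auto simp: scan_le_def)
  next
    case 4
    have "two_sided_factor T (a * v) v" if "a \<in> T" for a v
      using that T unfolding two_sided_factor_def factor_closed_def by (metis mult.right_neutral)
    with 4 show ?thesis by (cases s) (auto simp: scan_le_def)
  next
    case (5 i)
    then show ?thesis by (cases s) (auto simp: scan_le_def)
  next
    case (6 i b)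
    then show ?thesis by (cases s) (auto simp: scan_le_def)
  next
    case (7 i)
    \<comment> \<open>With a missing right factor this would break down: from
      \<open>x = a * v * c\<close> one cannot in general move \<open>b\<close> past
      \<open>c\<close>. Hence cancellation is tied to \<open>Inr 4\<close>, that is, to
      \<open>LDone\<close>.\<close>
    have "\<exists>a'\<in>T. a * v * b = a' * (v * b)" if "a \<in> T" for a v b
      using that by (auto simp: mult.assoc)
    with 7 show ?thesis by (cases s) (auto simp: scan_le_def)
  next
    case 8
    then show ?thesis by (cases s) (auto simp: scan_le_def)
  qed
qed

text \<open>\<open>Bad\<close> is not final, so only \<open>Bad\<close> is below it. The second
  claim thus shows that a word derived from a start word never scans to \<open>Bad\<close>.\<close>

lemma scan_le_rsteps:
  assumes T: "factor_closed T" and "rsteps (comparison_rules G D T Bs) n x y"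
  shows "scan_good T (foldl (scan_step Bs) Start y) \<Longrightarrow> scan_good T (foldl (scan_step Bs) Start x)"
    and "foldl (scan_step Bs) Start y = Bad \<Longrightarrow> foldl (scan_step Bs) Start x = Bad"
proof -
  have "(scan_good T (foldl (scan_step Bs) Start y) \<longrightarrow> scan_good T (foldl (scan_step Bs) Start x)) \<and>
    (foldl (scan_step Bs) Start y = Bad \<longrightarrow> foldl (scan_step Bs) Start x = Bad)"
    using assms(2)
  proof (induction rule: rsteps.induct)
    case (step x y n z)
    obtain p s l r where "(l, r) \<in> comparison_rules G D T Bs" "x = p @ l @ s" "y = p @ r @ s"
      using step.hyps(1) unfolding rstep_def by blast
    then have "scan_le T (foldl (scan_step Bs) Start x) (foldl (scan_step Bs) Start y)"
      using scan_le_foldl[OF T scan_le_rule[OF T]] by simp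
    with step.IH show ?case by (auto simp: scan_le_def)
  qed simp
  then show "scan_good T (foldl (scan_step Bs) Start y) \<Longrightarrow> scan_good T (foldl (scan_step Bs) Start x)"
    "foldl (scan_step Bs) Start y = Bad \<Longrightarrow> foldl (scan_step Bs) Start x = Bad" by blast+
qed

lemma scan_step_accept: "scan_step Bs s (Inr 3) = (if s = Start then LDone 1 1 else Bad)"
  by (cases s) auto

text \<open>The machine accepts on seeing \<open>Inr 3\<close> anywhere. The automaton survives this
  symbol only in state \<open>Start\<close>, and then no symbol may follow.\<close>

lemma scan_accepting_word:
  assumes "Inr 3 \<in> set y" "foldl (scan_step Bs) Start y \<noteq> Bad"
  shows "foldl (scan_step Bs) Start y = LDone 1 1"
proof -
  obtain p s where y: "y = p @ Inr 3 # s" using split_list[OF assms(1)] by blast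
  have "foldl (scan_step Bs) Start p = Start"
    using assms(2) unfolding y by (auto simp: scan_step_accept foldl_scan_Bad split: if_splits)
  moreover have "s = []"
    using assms(2) unfolding y by (cases s) (auto simp: scan_step_accept foldl_scan_Bad split: if_splits)
  ultimately show ?thesis unfolding y by simp
qed

lemma foldl_scan_Rgt_input:
  "foldl (scan_step Bs) (Rgt x v) (map Inl w) = Junk \<or>
    (\<exists>v'. w = map Some v' \<and> foldl (scan_step Bs) (Rgt x v) (map Inl w) = Rgt x (v * prod_list v'))"
proof (induction w arbitrary: v)
  case (Cons c w)
  have Junk: "foldl (scan_step Bs) Junk (map Inl w) = Junk" for w by (induction w) auto
  show ?case
  proof (cases c)
    case (Some a)
    show ?thesis using Cons[of "v * a"]
    proof (elim disjE exE conjE)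
      fix v' assume "w = map Some v'"
        "foldl (scan_step Bs) (Rgt x (v * a)) (map Inl w) = Rgt x (v * a * prod_list v')"
      then show ?thesis using Some by (intro disjI2 exI[of _ "a # v'"]) (simp add: mult.assoc)
    qed (use Some in simp)
  qed (simp add: Junk)
qed simp

text \<open>Inputs need not encode pairs: without a separator the state stays \<open>Lft\<close>,
  with several it ends as \<open>Junk\<close>, and the end marker sends both to
  \<open>JunkDone\<close>.\<close>

lemma foldl_scan_Lft_input:
  "foldl (scan_step Bs) (Lft x) (map Inl w) = Junk \<or> (\<exists>x'. foldl (scan_step Bs) (Lft x) (map Inl w) = Lft x') \<or>
    (\<exists>u v. w = map Some u @ None # map Some v \<and>
      foldl (scan_step Bs) (Lft x) (map Inl w) = Rgt (x * prod_list u) (prod_list v))"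
proof (induction w arbitrary: x)
  case (Cons c w)
  show ?case
  proof (cases c)
    case None
    show ?thesis using foldl_scan_Rgt_input[of Bs x 1 w]
    proof (elim disjE exE conjE)
      fix v' assume "w = map Some v'" "foldl (scan_step Bs) (Rgt x 1) (map Inl w) = Rgt x (1 * prod_list v')"
      then show ?thesis using None by (intro disjI2 exI[of _ "[]"] exI[of _ v']) simp
    qed (use None in simp)
  next
    case (Some a)
    show ?thesis using Cons[of "x * a"]
    proof (elim disjE exE conjE)
      fix u v assume "w = map Some u @ None # map Some v"
        "foldl (scan_step Bs) (Lft (x * a)) (map Inl w) = Rgt (x * a * prod_list u) (prod_list v)"
      then show ?thesis using Some by (intro disjI2 exI[of _ "a # u"] exI[of _ v]) (simp add: mult.assoc)
    qed (use Some in auto)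
  qed
qed simp

lemma comparison_rules_sound:
  assumes T: "factor_closed T" and "rsteps (comparison_rules G D T Bs) n (start_word w) y" "Inr 3 \<in> set y"
  shows "\<exists>u v. w = encode_pair u v \<and> two_sided_factor T (prod_list u) (prod_list v)"
proof -
  let ?scan = "foldl (scan_step Bs) Start"
  have start: "?scan (start_word w) = scan_step Bs (foldl (scan_step Bs) (Lft 1) (map Inl w)) (Inr 2)"
    by (simp add: start_word_def)
  have "?scan (start_word w) \<noteq> Bad"
    using foldl_scan_Lft_input[of Bs 1 w] unfolding start by auto
  then have "?scan y = LDone 1 1"
    using scan_le_rsteps(2)[OF T assms(2)] scan_accepting_word[OF assms(3)] by blast
  moreover have "1 \<in> T" using T unfolding factor_closed_def by blast
  ultimately have "scan_good T (?scan y)" by auto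
  then have "scan_good T (?scan (start_word w))" by (rule scan_le_rsteps(1)[OF T assms(2)])
  with foldl_scan_Lft_input[of Bs 1 w] obtain u v where
    "w = map Some u @ None # map Some v" "two_sided_factor T (prod_list u) (prod_list v)"
    unfolding start by (elim disjE exE conjE) auto
  then show ?thesis unfolding encode_pair_def by blast
qed

subsection \<open>Completeness\<close>

abbreviation pair_word :: "'m list \<Rightarrow> 'm list \<Rightarrow> nat \<Rightarrow> ('m option + nat) list" where
  "pair_word u v e \<equiv> Inr 1 # map letter u @ separator # map letter v @ [Inr e]"

lemma start_word_encode_pair: "start_word (encode_pair u v) = pair_word u v 2"
  by (simp add: start_word_def encode_pair_def)

context
  fixes G :: "'m::monoid_mult set" and D :: nat and T :: "'m set" and Bs :: "'m list"
begin

abbreviation "Rules \<equiv> comparison_rules G D T Bs"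

lemma rsteps_Rules_relators:
  assumes "rsteps (relators G D) n x y" "set x \<subseteq> G" "c = Inr 1 \<or> c = separator"
  shows "rsteps Rules n (c # map letter x) (c # map letter y)"
  using assms(1,2)
proof (induction rule: rsteps.induct)
  case (step x y n z)
  obtain p s l r where lr: "(l, r) \<in> relators G D" and x: "x = p @ l @ s" and y: "y = p @ r @ s"
    using step.hyps(1) unfolding rstep_def by blast
  have rule: "(c' # map letter l, c' # map letter r) \<in> Rules" if "c' = Inr 1 \<or> c' = separator \<or> c' \<in> letter ` G" for c'
    using that lr unfolding comparison_rules_def by (auto intro!: image_eqI[of _ _ "(c', l, r)"])
  \<comment> \<open>The symbol to the left of the redex that the tape rule requires: the last letter
    of \<open>p\<close>, or the marker \<open>c\<close> if \<open>p\<close> is empty.\<close>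
  have "\<exists>p' c'. c # map letter p = p' @ [c'] \<and> (c' = Inr 1 \<or> c' = separator \<or> c' \<in> letter ` G)"
  proof (cases p rule: rev_cases)
    case Nil
    then show ?thesis using assms(3) by (intro exI[of _ "[]"]) auto
  next
    case (snoc p' g)
    then show ?thesis using step.prems x by (intro exI[of _ "c # map letter p'"]) auto
  qed
  then obtain p' c' where c': "c # map letter p = p' @ [c']" "c' = Inr 1 \<or> c' = separator \<or> c' \<in> letter ` G"
    by blast
  have "rstep Rules (p' @ (c' # map letter l) @ map letter s) (p' @ (c' # map letter r) @ map letter s)"
    using rule[OF c'(2)] unfolding rstep_def by blast
  moreover have "c # map letter x = p' @ (c' # map letter l) @ map letter s"
    "c # map letter y = p' @ (c' # map letter r) @ map letter s"
    using c'(1) unfolding x y by (simp_all flip: append_Cons)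
  ultimately have "rstep Rules (c # map letter x) (c # map letter y)" by simp
  moreover have "set y \<subseteq> G" using step.prems x y lr by (auto simp: relators_def)
  ultimately show ?case using step.IH by (blast intro: rsteps.step)
qed (rule rsteps.refl)

lemma rsteps_Rules_first:
  assumes "rsteps (relators G D) n u u'" "set u \<subseteq> G"
  shows "rsteps Rules n (pair_word u v e) (pair_word u' v e)"
  using rsteps_suffix[OF rsteps_Rules_relators[OF assms, of "Inr 1"], of "separator # map letter v @ [Inr e]"]
  by simp

lemma rsteps_Rules_second:
  assumes "rsteps (relators G D) n v v'" "set v \<subseteq> G"
  shows "rsteps Rules n (pair_word u v e) (pair_word u v' e)"
  using rsteps_context[OF rsteps_Rules_relators[OF assms, of separator], of "Inr 1 # map letter u" "[Inr e]"]
  by simp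

lemma rsteps_Rules_insert_left:
  assumes "set a \<subseteq> set Bs \<inter> T"
  shows "rsteps Rules (length a) (pair_word u v e) (pair_word u (a @ v) e)"
  using assms
proof (induction a)
  case (Cons b a)
  then have "rsteps Rules (length a) (pair_word u v e) (pair_word u (a @ v) e)" by simp
  moreover have "rsteps Rules 1 ((Inr 1 # map letter u) @ [separator] @ (map letter (a @ v) @ [Inr e]))
      ((Inr 1 # map letter u) @ [separator, letter b] @ (map letter (a @ v) @ [Inr e]))"
    by (rule rsteps_rule) (use Cons.prems in \<open>auto simp: comparison_rules_def\<close>)
  ultimately show ?case using rsteps_trans by fastforce
qed (simp add: rsteps.refl)

lemma rsteps_Rules_insert_right:
  assumes "set a \<subseteq> set Bs \<inter> T"
  shows "rsteps Rules (length a) (pair_word u v 2) (pair_word u (v @ a) 2)"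
  using assms
proof (induction a rule: rev_induct)
  case (snoc b a)
  then have "rsteps Rules (length a) (pair_word u v 2) (pair_word u (v @ a) 2)" by simp
  moreover have "rsteps Rules 1 ((Inr 1 # map letter u @ separator # map letter (v @ a)) @ [Inr 2] @ [])
      ((Inr 1 # map letter u @ separator # map letter (v @ a)) @ [letter b, Inr 2] @ [])"
    by (rule rsteps_rule) (use snoc.prems in \<open>auto simp: comparison_rules_def\<close>)
  ultimately show ?case using rsteps_trans by fastforce
qed (simp add: rsteps.refl)

lemma rsteps_Rules_travel:
  assumes "i < length Bs" "set z \<subseteq> set Bs"
  shows "rsteps Rules (length z) (Inr (i + 5) # map letter z) (map letter z @ [Inr (i + 5)])"
  using assms(2)
proof (induction z)
  case (Cons b z)
  have "rsteps Rules 1 ([] @ [Inr (i + 5), letter b] @ map letter z) ([] @ [letter b, Inr (i + 5)] @ map letter z)"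
    by (rule rsteps_rule)
       (use Cons.prems assms(1) in \<open>auto simp: comparison_rules_def intro!: image_eqI[of _ _ "(i, b)"]\<close>)
  moreover have "rsteps Rules (length z) ([letter b] @ Inr (i + 5) # map letter z)
      ([letter b] @ map letter z @ [Inr (i + 5)])"
    by (rule rsteps_prefix) (use Cons in simp)
  ultimately show ?case using rsteps_trans by fastforce
qed (simp add: rsteps.refl)

text \<open>The words are consumed from the right: the last letter of the first copy touches the
  separator, travels across the whole second copy and meets its equal at the end.\<close>

lemma rsteps_Rules_compare:
  assumes "set g \<subseteq> set Bs"
  shows "rsteps Rules (length g * (length g + 2)) (pair_word g g 4) (pair_word [] [] 4)"
  using assms
proof (induction g rule: rev_induct)
  case (snoc b g)
  obtain i where i: "i < length Bs" "Bs ! i = b" using snoc.prems by (auto simp: in_set_conv_nth)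
  let ?g = "map letter g"
  have 1: "rsteps Rules 1 ((Inr 1 # ?g) @ [letter (Bs ! i), separator] @ map letter (g @ [b]) @ [Inr 4])
      ((Inr 1 # ?g) @ [separator, Inr (i + 5)] @ map letter (g @ [b]) @ [Inr 4])"
    by (rule rsteps_rule) (use i in \<open>auto simp: comparison_rules_def\<close>)
  have "rsteps Rules (length (g @ [b])) ((Inr 1 # ?g @ [separator]) @ (Inr (i + 5) # map letter (g @ [b])) @ [Inr 4])
      ((Inr 1 # ?g @ [separator]) @ (map letter (g @ [b]) @ [Inr (i + 5)]) @ [Inr 4])"
    by (rule rsteps_context[OF rsteps_Rules_travel]) (use i snoc.prems in auto)
  then have 2: "rsteps Rules (length (g @ [b])) ((Inr 1 # ?g) @ [separator, Inr (i + 5)] @ map letter (g @ [b]) @ [Inr 4])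
     ((Inr 1 # ?g @ separator # ?g) @ [letter (Bs ! i), Inr (i + 5), Inr 4] @ [])"
    using i by simp
  have 3: "rsteps Rules 1 ((Inr 1 # ?g @ separator # ?g) @ [letter (Bs ! i), Inr (i + 5), Inr 4] @ [])
      ((Inr 1 # ?g @ separator # ?g) @ [Inr 4] @ [])"
    by (rule rsteps_rule) (use i in \<open>auto simp: comparison_rules_def\<close>)
  have "rsteps Rules (1 + length (g @ [b]) + 1) (pair_word (g @ [b]) (g @ [b]) 4) (pair_word g g 4)"
    using rsteps_trans[OF rsteps_trans[OF 1 2] 3] i by simp
  moreover have "rsteps Rules (length g * (length g + 2)) (pair_word g g 4) (pair_word [] [] 4)"
    using snoc by simp
  ultimately show ?case by (rule rsteps_trans_le) simp
qed (simp add: rsteps.refl)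

lemma rsteps_Rules_accept:
  assumes "set g \<subseteq> set Bs"
  shows "rsteps Rules (length g * (length g + 2) + 2) (pair_word g g 2) [Inr 3]"
proof -
  have "rsteps Rules 1 ((Inr 1 # map letter g @ separator # map letter g) @ [Inr 2] @ [])
      ((Inr 1 # map letter g @ separator # map letter g) @ [Inr 4] @ [])"
    by (rule rsteps_rule) (auto simp: comparison_rules_def)
  then have 1: "rsteps Rules 1 (pair_word g g 2) (pair_word g g 4)" by simp
  have "rsteps Rules 1 ([] @ [Inr 1, separator, Inr 4] @ []) ([] @ [Inr 3] @ [])"
    by (rule rsteps_rule) (auto simp: comparison_rules_def)
  then have 3: "rsteps Rules 1 (pair_word [] [] 4) [Inr 3]" by simp
  show ?thesis
    by (rule rsteps_trans_le[OF rsteps_trans[OF 1 rsteps_Rules_compare[OF assms]] 3]) simp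
qed

end

text \<open>Changes the alphabet: a letter of \<open>A\<close> and the word \<open>e a\<close> for
  it form a relator over \<open>G\<close>, so input words can be turned into words over the
  hyperbolic generating set.\<close>

lemma rsteps_translate:
  assumes "set u \<subseteq> A" "A \<subseteq> G" "0 < D"
    and e: "\<And>a. a \<in> A \<Longrightarrow> set (e a) \<subseteq> G \<and> length (e a) \<le> D \<and> prod_list (e a) = a"
  shows "rsteps (relators G D) (length u) u (concat (map e u)) \<and> prod_list (concat (map e u)) = prod_list u"
  using assms(1)
proof (induction u)
  case (Cons a u)
  then have a: "a \<in> A" and IH: "rsteps (relators G D) (length u) u (concat (map e u))"
    "prod_list (concat (map e u)) = prod_list u" by auto
  have "rsteps (relators G D) 1 ([] @ [a] @ u) ([] @ e a @ u)"
    by (rule rsteps_rule) (use a e[OF a] assms(2,3) in \<open>auto intro!: relatorsI\<close>)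
  then have "rsteps (relators G D) 1 (a # u) (e a @ u)" by simp
  from rsteps_trans[OF this rsteps_prefix[OF IH(1), of "e a"]]
  show ?case using IH(2) e[OF a] by simp
qed (simp add: rsteps.refl)

context hyperbolic_monoid
begin

theorem two_sided_factor_in_NP:
  fixes A T :: "'m set"
  assumes T: "factor_closed T" and indeg: "bounded_indegree TYPE('m)" and A: "fin_gen_set A"
  shows "rel_in_NP A (two_sided_factor T)"
proof -
  have finB: "finite B" and finA: "finite A" using gen A by (auto simp: fin_gen_set_def)
  obtain Bs where Bs: "set Bs = B" using finite_list[OF finB] by blast
  obtain e where e: "\<And>a. geod (e a) \<and> prod_list (e a) = a" using ex_geod by metis
  define K where "K = (\<Sum>a\<in>A. length (e a))"
  have K: "length (e a) \<le> K" if "a \<in> A" for a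
    unfolding K_def using that finA by (intro member_le_sum) auto
  \<comment> \<open>One \<open>D\<close> serves two purposes: \<open>6 * \<delta> + 6\<close> for
    filling triangles, \<open>K\<close> for translating a letter of \<open>A\<close>.\<close>
  define D where "D = 6 * \<delta> + 6 + K"
  define G where "G = A \<union> B"
  have BG: "B \<subseteq> G" and AG: "A \<subseteq> G" and D: "6 * \<delta> + 6 \<le> D" "0 < D" "K \<le> D"
    by (auto simp: G_def D_def)
  let ?R = "comparison_rules G D T Bs"
  obtain C where C: "\<And>x y. two_sided_factor T x y \<Longrightarrow>
    \<exists>a\<in>T. \<exists>b\<in>T. x = a * y * b \<and> wlen a \<le> C * (wlen x + wlen y + 1) \<and> wlen b \<le> C * (wlen x + wlen y + 1)"
    using linear_bound_two_sided_factors[OF T indeg] unfolding two_sided_factor_def by blast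
  \<comment> \<open>\<open>?h\<close> is the cubic cost of straightening, \<open>l\<close> bounds
    the length of \<open>e a @ ?v @ e b\<close>, and the seven summands of \<open>f\<close> pay for
    the derivations \<open>1\<close> to \<open>7\<close> below.\<close>
  let ?h = "\<lambda>n::nat. n * ((n + 1) * (n + 4))"
  define l where "l = (\<lambda>n. C * (K * n + 1) + K * n + C * (K * n + 1))"
  define f where "f = (\<lambda>n. n + ?h (K * n) + n + C * (K * n + 1) + C * (K * n + 1) + ?h (l n) +
    (K * n * (K * n + 2) + 2))"
  have "poly_bounded f" unfolding f_def l_def by (intro poly_bounded_intros)
  have h_mono: "?h m \<le> ?h n" if "m \<le> n" for m n using that by (intro mult_le_mono) auto
  have complete: "\<exists>y. rsteps ?R (f (length (encode_pair u v))) (start_word (encode_pair u v)) y \<and> Inr 3 \<in> set y"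
    if uv: "set u \<subseteq> A" "set v \<subseteq> A" "two_sided_factor T (prod_list u) (prod_list v)" for u v
  proof -
    let ?n = "length (encode_pair u v)"
    let ?u = "concat (map e u)" and ?v = "concat (map e v)"
    have len: "length (concat (map e z)) \<le> K * length z" if "set z \<subseteq> A" for z
      using that K by (induction z) (auto simp: add_mono)
    have n: "?n = length u + length v + 1" by (simp add: encode_pair_def)
    have lenuv: "length ?u + length ?v \<le> K * ?n" "length ?u \<le> K * ?n" "length ?v \<le> K * ?n"
      using len[OF uv(1)] len[OF uv(2)] unfolding n by (simp_all add: algebra_simps)
    have setuv: "set ?u \<subseteq> B" "set ?v \<subseteq> B" using e geod_set by auto
    have eA: "set (e a) \<subseteq> G \<and> length (e a) \<le> D \<and> prod_list (e a) = a" if "a \<in> A" for a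
      using e[of a] geod_set[of "e a"] K[OF that] D(3) BG by auto
    have tr: "rsteps (relators G D) (length z) z (concat (map e z)) \<and> prod_list (concat (map e z)) = prod_list z"
      if "set z \<subseteq> A" for z
      by (rule rsteps_translate[OF that AG D(2) eA])
    obtain a b where ab: "a \<in> T" "b \<in> T" "prod_list u = a * prod_list v * b"
      "wlen a \<le> C * (wlen (prod_list u) + wlen (prod_list v) + 1)"
      "wlen b \<le> C * (wlen (prod_list u) + wlen (prod_list v) + 1)"
      using C[OF uv(3)] by blast
    have wlen_uv: "wlen (prod_list u) \<le> length ?u" "wlen (prod_list v) \<le> length ?v"
      using wlen_le[OF setuv(1)] wlen_le[OF setuv(2)] tr[OF uv(1)] tr[OF uv(2)] by simp_all
    then have "wlen (prod_list u) + wlen (prod_list v) + 1 \<le> K * ?n + 1" using lenuv(1) by simp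
    then have "C * (wlen (prod_list u) + wlen (prod_list v) + 1) \<le> C * (K * ?n + 1)" by (rule mult_le_mono2)
    then have "wlen a \<le> C * (K * ?n + 1)" "wlen b \<le> C * (K * ?n + 1)"
      using ab(4,5) by (meson le_trans)+
    then have wlen_ab: "length (e a) \<le> C * (K * ?n + 1)" "length (e b) \<le> C * (K * ?n + 1)"
      using geod_length[of "e a"] geod_length[of "e b"] e by simp_all
    \<comment> \<open>The insertion rules offer only letters in \<open>T\<close>; closure under
      factors makes these suffice to spell elements of \<open>T\<close>.\<close>
    have letters_T: "set (e c) \<subseteq> set Bs \<inter> T" if "c \<in> T" for c
    proof -
      have "set w \<subseteq> T" if "prod_list w \<in> T" for w
        using that T unfolding factor_closed_def by (induction w) auto
      then show ?thesis using e[of c] that geod_set Bs by auto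
    qed
    let ?v' = "e a @ ?v @ e b" and ?g = "e (prod_list u)"
    have v': "set ?v' \<subseteq> B" "length ?v' \<le> l ?n" "prod_list ?v' = prod_list u"
      using e geod_set setuv wlen_ab lenuv(3) ab(3) tr[OF uv(2)] by (auto simp: l_def mult.assoc)
    have g: "geod ?g" "prod_list ?g = prod_list u" "length ?g \<le> K * ?n" "set ?g \<subseteq> set Bs"
      using e geod_length[of ?g] geod_set[of ?g] wlen_uv(1) lenuv(2) Bs by auto
    have 1: "rsteps ?R (length u) (pair_word u v 2) (pair_word ?u v 2)"
      by (rule rsteps_Rules_first) (use tr[OF uv(1)] uv(1) AG in auto)
    have 2: "rsteps ?R (?h (length ?u)) (pair_word ?u v 2) (pair_word ?g v 2)"
      by (intro rsteps_Rules_first rsteps_to_geodesic[OF BG D(1)])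
         (use setuv g tr[OF uv(1)] BG in auto)
    have 3: "rsteps ?R (length v) (pair_word ?g v 2) (pair_word ?g ?v 2)"
      by (rule rsteps_Rules_second) (use tr[OF uv(2)] uv(2) AG in auto)
    have 4: "rsteps ?R (length (e a)) (pair_word ?g ?v 2) (pair_word ?g (e a @ ?v) 2)"
      by (rule rsteps_Rules_insert_left[OF letters_T[OF ab(1)]])
    have 5: "rsteps ?R (length (e b)) (pair_word ?g (e a @ ?v) 2) (pair_word ?g ((e a @ ?v) @ e b) 2)"
      by (rule rsteps_Rules_insert_right[OF letters_T[OF ab(2)]])
    have 6: "rsteps ?R (?h (length ?v')) (pair_word ?g ((e a @ ?v) @ e b) 2) (pair_word ?g ?g 2)"
      unfolding append_assoc
      by (intro rsteps_Rules_second rsteps_to_geodesic[OF BG D(1)]) (use v' g BG in auto)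
    have 7: "rsteps ?R (length ?g * (length ?g + 2) + 2) (pair_word ?g ?g 2) [Inr 3]"
      by (rule rsteps_Rules_accept[OF g(4)])
    have "rsteps ?R (f ?n) (pair_word u v 2) [Inr 3]"
    proof (rule rsteps_trans_le[OF rsteps_trans[OF rsteps_trans[OF rsteps_trans[OF rsteps_trans[OF
            rsteps_trans[OF 1 2] 3] 4] 5] 6] 7])
      show "length u + ?h (length ?u) + length v + length (e a) + length (e b) + ?h (length ?v') +
          (length ?g * (length ?g + 2) + 2) \<le> f ?n"
        unfolding f_def using n wlen_ab
        by (intro add_mono h_mono mult_le_mono) (use n lenuv v' g in auto)
    qed
    then show ?thesis unfolding start_word_encode_pair by (intro exI[of _ "[Inr 3]"]) simp
  qed
  let ?\<Sigma> = "insert None (Some ` A)"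
  let ?L = "{encode_pair u v | u v. set u \<subseteq> A \<and> set v \<subseteq> A \<and> two_sided_factor T (prod_list u) (prod_list v)}"
  have "in_NP ?\<Sigma> ?L"
  proof (rule in_NP_rewriting[where R = ?R and f = f])
    show "finite ?\<Sigma>" using finA by simp
    show "finite ?R"
      unfolding comparison_rules_def using finA finB finite_relators[of G D] by (auto simp: G_def)
    show "Inr 0 \<notin> set x \<union> set y" if "(x, y) \<in> ?R" for x y
      using that unfolding comparison_rules_def by auto
    show "w \<in> ?L" if acc: "w \<in> lists ?\<Sigma>" "rsteps ?R n (start_word w) y" "Inr 3 \<in> set y" for w n y
    proof -
      obtain u v where w: "w = encode_pair u v" "two_sided_factor T (prod_list u) (prod_list v)"
        using comparison_rules_sound[OF T acc(2,3)] by blast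
      moreover have "set u \<subseteq> A" "set v \<subseteq> A"
        using acc(1) unfolding w encode_pair_def by (auto simp: lists_eq_set)
      ultimately show ?thesis by blast
    qed
    show "\<exists>y. rsteps ?R (f (length w)) (start_word w) y \<and> Inr 3 \<in> set y" if "w \<in> ?L" for w
      using that complete by blast
  qed fact
  then show ?thesis unfolding rel_in_NP_def .
qed

end

section \<open>Green's relations\<close>

lemma J_le_iff: "J_le = two_sided_factor UNIV"
proof (intro ext iffI)
  fix x y :: 'a
  assume "J_le x y"
  then have "1 * x * 1 \<in> {a * y * b | a b. True}" unfolding J_le_def by blast
  then show "two_sided_factor UNIV x y" by (auto simp: two_sided_factor_def)
next
  fix x y :: 'a
  assume "two_sided_factor UNIV x y"
  then obtain a b where x: "x = a * y * b" by (auto simp: two_sided_factor_def)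
  have "c * x * d = c * a * y * (b * d)" for c d unfolding x by (simp add: mult.assoc)
  then show "J_le x y" unfolding J_le_def by blast
qed

lemma factor_closed_UNIV: "factor_closed UNIV"
  by (simp add: factor_closed_def)

section \<open>Units and the D-relation of a cancellative monoid\<close>

definition monoid_units :: "'m::monoid_mult set" where
  "monoid_units = {u. \<exists>v. u * v = 1 \<and> v * u = 1}"

lemma monoid_unitsI: "u * v = 1 \<Longrightarrow> v * u = 1 \<Longrightarrow> u \<in> monoid_units"
  unfolding monoid_units_def by blast

text \<open>Cancellation makes one-sided inverses two-sided: an inverse \<open>z\<close> of
  \<open>x * y\<close> yields the right inverse \<open>y * z\<close> of \<open>x\<close> and the
  left inverse \<open>z * x\<close> of \<open>y\<close>.\<close>

lemma factor_closed_monoid_units: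
  assumes "cancellative TYPE('m::monoid_mult)"
  shows "factor_closed (monoid_units :: 'm set)"
proof -
  have lc: "a * b = a * c \<Longrightarrow> b = c" and rc: "b * a = c * a \<Longrightarrow> b = c" for a b c :: 'm
    using assms unfolding cancellative_def left_cancellative_def right_cancellative_def by blast+
  have "x * y \<in> monoid_units \<longleftrightarrow> x \<in> monoid_units \<and> y \<in> monoid_units" for x y :: 'm
  proof (intro iffI conjI)
    assume "x * y \<in> monoid_units"
    then obtain z where z: "x * y * z = 1" "z * (x * y) = 1" unfolding monoid_units_def by blast
    have "x * (y * z * x) = x * 1" using z(1) by (simp flip: mult.assoc)
    then have "y * z * x = 1" by (rule lc)
    then show "x \<in> monoid_units" using z(1) by (intro monoid_unitsI[of _ "y * z"]) (auto simp: mult.assoc)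
    have "y * (z * x) * y = 1 * y" using z(2) by (simp add: mult.assoc)
    then have "y * (z * x) = 1" by (rule rc)
    then show "y \<in> monoid_units" using z(2) by (intro monoid_unitsI[of _ "z * x"]) (auto simp: mult.assoc)
  next
    assume "x \<in> monoid_units \<and> y \<in> monoid_units"
    then obtain x' y' where "x * x' = 1" "x' * x = 1" "y * y' = 1" "y' * y = 1"
      unfolding monoid_units_def by blast
    then show "x * y \<in> monoid_units"
      by (intro monoid_unitsI[of _ "y' * x'"]) (metis mult.assoc mult.right_neutral)+
  qed
  moreover have "(1::'m) \<in> monoid_units" by (rule monoid_unitsI[of _ 1]) auto
  ultimately show ?thesis unfolding factor_closed_def by blast
qed

text \<open>From \<open>x = p * c\<close> and \<open>c = q * x\<close>, right cancellation makes
  \<open>p\<close> and \<open>q\<close> mutually inverse. So L-related elements differ by a unit on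
  the left and, dually, R-related ones by a unit on the right. Conversely \<open>y * g\<close>
  serves as the intermediate element.\<close>

lemma D_rel_iff:
  assumes "cancellative TYPE('m::monoid_mult)"
  shows "(D_rel :: 'm \<Rightarrow> 'm \<Rightarrow> bool) = two_sided_factor monoid_units"
proof (intro ext iffI)
  fix x y :: 'm
  have lc: "a * b = a * c \<Longrightarrow> b = c" and rc: "b * a = c * a \<Longrightarrow> b = c" for a b c :: 'm
    using assms unfolding cancellative_def left_cancellative_def right_cancellative_def by blast+
  assume "D_rel x y"
  then obtain c where L: "{a * x | a. True} = {a * c | a. True}" and R: "{c * a | a. True} = {y * a | a. True}"
    unfolding D_rel_def L_rel_def R_rel_def by blast
  have "1 * x \<in> {a * c | a. True}" "1 * c \<in> {a * x | a. True}" using L by blast+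
  then obtain p q where p: "x = p * c" "c = q * x" by auto
  have "c * 1 \<in> {y * a | a. True}" "y * 1 \<in> {c * a | a. True}" using R by blast+
  then obtain g h where g: "c = y * g" "y = c * h" by auto
  have "p * q * x = 1 * x" "q * p * c = 1 * c" using p by (simp_all add: mult.assoc)
  then have "p \<in> monoid_units" using rc monoid_unitsI by metis
  moreover have "c * (h * g) = c * 1" "y * (g * h) = y * 1" using g by (simp_all flip: mult.assoc)
  then have "g \<in> monoid_units" using lc monoid_unitsI by metis
  moreover have "x = p * y * g" using p(1) g(1) by (simp add: mult.assoc)
  ultimately show "two_sided_factor monoid_units x y" unfolding two_sided_factor_def by blast
next
  fix x y :: 'm
  assume "two_sided_factor monoid_units x y"
  then obtain p p' g g' where x: "x = p * y * g" and u: "p' * p = 1" "g * g' = 1"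
    unfolding two_sided_factor_def monoid_units_def by blast
  have "a * x = a * p * (y * g)" "a * (y * g) = a * p' * x" for a
  proof -
    show "a * x = a * p * (y * g)" unfolding x by (simp add: mult.assoc)
    have "a * p' * x = a * (p' * p) * (y * g)" unfolding x by (simp only: mult.assoc)
    then show "a * (y * g) = a * p' * x" using u by simp
  qed
  then have "L_rel x (y * g)" unfolding L_rel_def by blast
  moreover have "y * g * a = y * (g * a)" "y * a = y * g * (g' * a)" for a
  proof -
    show "y * g * a = y * (g * a)" by (simp add: mult.assoc)
    have "y * g * (g' * a) = y * (g * g') * a" by (simp only: mult.assoc)
    then show "y * a = y * g * (g' * a)" using u by simp
  qed
  then have "R_rel (y * g) y" unfolding R_rel_def by blast
  ultimately show "D_rel x y" unfolding D_rel_def by blast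
qed

theorem theorem6p6:
  assumes "left_cancellative TYPE('m::monoid_mult)"
    and "bounded_indegree TYPE('m)"
    and "strongly_hyperbolic TYPE('m)"
  shows "(\<forall>A::'m set. fin_gen_set A \<longrightarrow> rel_in_NP A J_le) \<and>
         (cancellative TYPE('m) \<longrightarrow> (\<forall>A::'m set. fin_gen_set A \<longrightarrow> rel_in_NP A D_rel))"
proof -
  obtain B :: "'m set" and \<delta> where "fin_gen_set B" "strongly_hyperbolic_wrt B \<delta>"
    using assms(3) unfolding strongly_hyperbolic_def by blast
  then interpret hyperbolic_monoid B \<delta>
    using assms(1) by unfold_locales
  show ?thesis
    using two_sided_factor_in_NP[OF factor_closed_UNIV assms(2)]
      two_sided_factor_in_NP[OF factor_closed_monoid_units assms(2)]
    by (simp add: J_le_iff D_rel_iff)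
qed

end
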